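(* Let $f\in L^2(\mu)$ with $f\neq0$ and $\int f\,d\mu=0$. Assume that the process is strongly mixing (i.e. uniformly ergodic) and that $\mathrm{Var}_\mu(S_t)=t\,h(t)$ for some slowly varying function $h$. If the CLT holds under $\mathbb P_\mu$ with $s_t^2=\mathrm{Var}_\mu(S_t)=t\,h(t)$, then the FCLT holds (under $\mathbb P_\mu$) with $s_t^2=\mathrm{Var}_\mu(S_t)=t\,h(t)$.
   Context: $(X_t)_{t\ge0}$ is a continuous-time strong Markov diffusion process (continuous sample paths) with state space $\mathbb R^d$, non explosive, irreducible, positive recurrent, with unique invariant probability measure $\mu$. $\mathbb P_\mu$, $\mathrm{Var}_\mu$ refer to the process with $X_0\sim\mu$; $P_tf(x)=\mathbb E(f(X_t)\mid X_0=x)$. $S_t=\int_0^tf(X_s)\,ds$. A non-negative function $h$ is slowly varying if $\lim_{t\to+\infty}h(ut)/h(t)=1$ for all $u>0$. Strong mixing: let $\mathcal F_s$ (resp. $\mathcal G_s$) be the $\sigma$-field generated by $(X_u)_{u\le s}$ (resp. $(X_u)_{u\ge s}$), and let $\alpha_{mix}(r)=\sup|\mathrm{Cov}(F,G)|$ (covariance under $\mathbb P_\mu$), the supremum being over $s\ge0$ and over $F$ (resp. $G$) $\mathcal F_s$- (resp. $\mathcal G_{s+r}$-) measurable, non-negative and bounded by $1$. The process is strongly mixing if $\lim_{r\to\infty}\alpha_{mix}(r)=0$; this is equivalent to uniform ergodicity, i.e. $\alpha(t):=\sup\{\|P_tg\|_{L^2(\mu)}:\|g\|_{L^\infty(\mu)}=1,\int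 g\,d\mu=0\}\to0$ as $t\to\infty$. CLT with normalization $s_t$: $S_t/s_t$ converges in law to $\mathcal N(0,1)$ as $t\to\infty$. FCLT with normalization $s_t$ (a deterministic positive function): for every finite sequence $0<t_1\le\cdots\le t_n<\infty$, the vector $\left(S_{t_1/\varepsilon}/s_{1/\varepsilon},\ldots,S_{t_n/\varepsilon}/s_{1/\varepsilon}\right)$ converges in law, as $\varepsilon\to0$, to $(B_{t_1},\ldots,B_{t_n})$, where $(B_t)_{t\ge0}$ is a standard Brownian motion on $\mathbb R$. *)

theory Defs
  imports "HOL-Probability.Probability"
begin

section \<open>Sigma-fields generated by a process\<close>

text \<open>
  Processes are indexed by \<^typ>\<open>real\<close>; only times \<open>u \<ge> 0\<close> are meaningful. The past is
  indexed by \<^typ>\<open>ennreal\<close>, so that stopping times with values in \<open>[0,\<infinity>]\<close> are covered by the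
  notions \<^const>\<open>stopping_time\<close> and \<open>filtration.pre_sigma\<close> of the library. Of the measure
  \<open>M\<close> only the underlying space is used.
\<close>

definition past :: "'w measure \<Rightarrow> (real \<Rightarrow> 'w \<Rightarrow> 'a::topological_space) \<Rightarrow> ennreal \<Rightarrow> 'w measure" where
  "past M X t = sigma (space M)
     {X u -` A \<inter> space M | u A. 0 \<le> u \<and> ennreal u \<le> t \<and> A \<in> sets borel}"

definition future :: "'w measure \<Rightarrow> (real \<Rightarrow> 'w \<Rightarrow> 'a::topological_space) \<Rightarrow> real \<Rightarrow> 'w measure" where
  "future M X t = sigma (space M)
     {X u -` A \<inter> space M | u A. 0 \<le> u \<and> t \<le> u \<and> A \<in> sets borel}"

lemma filtration_past: "filtration (space M) (past M X)"
proof
  show "space (past M X t) = space M" for t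
    unfolding past_def by (intro space_measure_of) auto
  show "sets (past M X s) \<subseteq> sets (past M X t)" if "s \<le> t" for s t
    unfolding past_def using that
    by (subst (1 2) sets_measure_of, blast, blast) (intro sigma_sets_mono', blast intro: order_trans)
qed


section \<open>Strong Markov diffusions on Euclidean space\<close>

text \<open>\<open>Q x\<close> is the law of the process started at \<open>x\<close>, and \<open>\<mu> \<bind> Q\<close> its law for the initial
  distribution \<open>\<mu>\<close>.\<close>

definition semigroup_op ::
    "(real \<Rightarrow> 'w \<Rightarrow> 'a) \<Rightarrow> ('a \<Rightarrow> 'w measure) \<Rightarrow> real \<Rightarrow> ('a \<Rightarrow> real) \<Rightarrow> 'a \<Rightarrow> real" where
  "semigroup_op X Q t g x = (\<integral>\<omega>. g (X t \<omega>) \<partial>Q x)"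

text \<open>
  On \<open>{T < \<infinity>}\<close>, \<open>E\<^sub>x[g (X (T + t)) | F\<^sub>T] = (P\<^sub>t g) (X T)\<close>, for all stopping times of
  the (uncompleted) natural filtration.
\<close>

definition strong_markov ::
    "'w measure \<Rightarrow> (real \<Rightarrow> 'w \<Rightarrow> 'a::topological_space) \<Rightarrow> ('a \<Rightarrow> 'w measure) \<Rightarrow> bool" where
  "strong_markov M X Q \<longleftrightarrow>
     (\<forall>x T t g. stopping_time (past M X) T \<longrightarrow> 0 \<le> t \<longrightarrow>
        g \<in> borel_measurable borel \<longrightarrow> bounded (range g) \<longrightarrow>
        (AE \<omega> in Q x.
           real_cond_exp (Q x) (filtration.pre_sigma (space M) (past M X) T)
             (\<lambda>\<omega>. if T \<omega> < \<infinity> then g (X (enn2real (T \<omega>) + t) \<omega>) else 0) \<omega>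
           = (if T \<omega> < \<infinity> then semigroup_op X Q t g (X (enn2real (T \<omega>)) \<omega>) else 0)))"

text \<open>
  Non-explosion is built in: the paths are continuous on the whole of \<open>[0,\<infinity>)\<close> with values in
  the Euclidean space, without a cemetery point.
\<close>

locale diffusion =
  fixes M :: "'w measure" and X :: "real \<Rightarrow> 'w \<Rightarrow> real ^ 'd" and Q :: "real ^ 'd \<Rightarrow> 'w measure"
  assumes measurable_X: "\<And>t. 0 \<le> t \<Longrightarrow> X t \<in> borel_measurable M"
    and kernel_Q: "Q \<in> borel \<rightarrow>\<^sub>M prob_algebra M"
    and continuous_paths: "\<And>\<omega>. \<omega> \<in> space M \<Longrightarrow> continuous_on {0..} (\<lambda>t. X t \<omega>)"
    and start: "\<And>x. AE \<omega> in Q x. X 0 \<omega> = x"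
    and strong_markov: "strong_markov M X Q"

definition invariant_prob ::
    "(real \<Rightarrow> 'w \<Rightarrow> 'a::topological_space) \<Rightarrow> ('a \<Rightarrow> 'w measure) \<Rightarrow> 'a measure \<Rightarrow> bool" where
  "invariant_prob X Q \<nu> \<longleftrightarrow> prob_space \<nu> \<and> sets \<nu> = sets borel \<and>
     (\<forall>t\<ge>0. \<nu> \<bind> (\<lambda>x. distr (Q x) borel (X t)) = \<nu>)"

text \<open>Potential kernel: the expected total time spent in \<open>A\<close> by the process started at \<open>x\<close>.\<close>

definition expected_occupation ::
    "(real \<Rightarrow> 'w \<Rightarrow> 'a) \<Rightarrow> ('a \<Rightarrow> 'w measure) \<Rightarrow> 'a \<Rightarrow> 'a set \<Rightarrow> ennreal" where
  "expected_occupation X Q x A =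
     (\<integral>\<^sup>+ \<omega>. (\<integral>\<^sup>+ s\<in>{0..}. indicator A (X s \<omega>) \<partial>lborel) \<partial>Q x)"

text \<open>
  Irreducibility and recurrence in the sense of Meyn and Tweedie, with respect to some
  reference measure.
\<close>

definition nontrivial_reference :: "'a::topological_space measure \<Rightarrow> bool" where
  "nontrivial_reference \<phi> \<longleftrightarrow>
     sets \<phi> = sets borel \<and> sigma_finite_measure \<phi> \<and> emeasure \<phi> UNIV \<noteq> 0"

definition irreducible_process ::
    "(real \<Rightarrow> 'w \<Rightarrow> 'a::topological_space) \<Rightarrow> ('a \<Rightarrow> 'w measure) \<Rightarrow> bool" where
  "irreducible_process X Q \<longleftrightarrow> (\<exists>\<phi>. nontrivial_reference \<phi> \<and>
     (\<forall>x. \<forall>A\<in>sets borel. 0 < emeasure \<phi> A \<longrightarrow> 0 < expected_occupation X Q x A))"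

definition recurrent_process ::
    "(real \<Rightarrow> 'w \<Rightarrow> 'a::topological_space) \<Rightarrow> ('a \<Rightarrow> 'w measure) \<Rightarrow> bool" where
  "recurrent_process X Q \<longleftrightarrow> (\<exists>\<phi>. nontrivial_reference \<phi> \<and>
     (\<forall>x. \<forall>A\<in>sets borel. 0 < emeasure \<phi> A \<longrightarrow> expected_occupation X Q x A = \<infinity>))"

definition positive_recurrent_process ::
    "(real \<Rightarrow> 'w \<Rightarrow> 'a::topological_space) \<Rightarrow> ('a \<Rightarrow> 'w measure) \<Rightarrow> bool" where
  "positive_recurrent_process X Q \<longleftrightarrow> recurrent_process X Q \<and> (\<exists>\<nu>. invariant_prob X Q \<nu>)"

locale ergodic_diffusion = diffusion M X Q
  for M :: "'w measure" and X :: "real \<Rightarrow> 'w \<Rightarrow> real ^ 'd" and Q :: "real ^ 'd \<Rightarrow> 'w measure" +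
  fixes \<mu> :: "(real ^ 'd) measure"
  assumes irreducible: "irreducible_process X Q"
    and positive_recurrent: "positive_recurrent_process X Q"
    and invariant: "invariant_prob X Q \<mu>"
    and unique_invariant: "\<And>\<nu>. invariant_prob X Q \<nu> \<Longrightarrow> \<nu> = \<mu>"


section \<open>Strong mixing\<close>

definition covariance :: "'w measure \<Rightarrow> ('w \<Rightarrow> real) \<Rightarrow> ('w \<Rightarrow> real) \<Rightarrow> real" where
  "covariance P F G = (\<integral>\<omega>. F \<omega> * G \<omega> \<partial>P) - (\<integral>\<omega>. F \<omega> \<partial>P) * (\<integral>\<omega>. G \<omega> \<partial>P)"

text \<open>For a probability measure \<open>P\<close> the supremum is over a nonempty set bounded by \<open>1\<close>.\<close>

definition alpha_mix ::
    "'w measure \<Rightarrow> (real \<Rightarrow> 'w \<Rightarrow> 'a::topological_space) \<Rightarrow> real \<Rightarrow> real" where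
  "alpha_mix P X r = Sup {\<bar>covariance P F G\<bar> | F G s. 0 \<le> s \<and>
     F \<in> borel_measurable (past P X (ennreal s)) \<and>
     G \<in> borel_measurable (future P X (s + r)) \<and>
     (\<forall>\<omega>\<in>space P. 0 \<le> F \<omega> \<and> F \<omega> \<le> 1 \<and> 0 \<le> G \<omega> \<and> G \<omega> \<le> 1)}"

definition strongly_mixing ::
    "'w measure \<Rightarrow> (real \<Rightarrow> 'w \<Rightarrow> 'a::topological_space) \<Rightarrow> bool" where
  "strongly_mixing P X \<longleftrightarrow> (alpha_mix P X \<longlongrightarrow> 0) at_top"


section \<open>Convergence in law, Brownian motion, limit theorems\<close>

definition slowly_varying :: "(real \<Rightarrow> real) \<Rightarrow> bool" where
  "slowly_varying h \<longleftrightarrow> (\<forall>t>0. 0 \<le> h t) \<and> (\<forall>u>0. ((\<lambda>t. h (u * t) / h t) \<longlongrightarrow> 1) at_top)"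

text \<open>
  The library's \<^const>\<open>weak_conv_m\<close> only covers sequences of measures on the real line.
\<close>

definition converges_in_law ::
    "('i \<Rightarrow> 'b::topological_space measure) \<Rightarrow> 'b measure \<Rightarrow> 'i filter \<Rightarrow> bool" where
  "converges_in_law N L F \<longleftrightarrow> (\<forall>g::'b \<Rightarrow> real. continuous_on UNIV g \<longrightarrow> bounded (range g) \<longrightarrow>
     ((\<lambda>i. \<integral>x. g x \<partial>N i) \<longlongrightarrow> (\<integral>x. g x \<partial>L)) F)"

lemma converges_in_law_sequentially_iff_weak_conv_m:
  fixes N :: "nat \<Rightarrow> real measure"
  assumes "\<And>n. real_distribution (N n)" "real_distribution L"
  shows "converges_in_law N L sequentially \<longleftrightarrow> weak_conv_m N L"
proof
  assume "converges_in_law N L sequentially"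
  then show "weak_conv_m N L"
    using assms unfolding converges_in_law_def
    by (intro integral_bdd_continuous_conv_imp_weak_conv)
       (auto simp: continuous_on_eq_continuous_at bounded_iff)
next
  assume w: "weak_conv_m N L"
  show "converges_in_law N L sequentially"
    unfolding converges_in_law_def
  proof (intro allI impI)
    fix g :: "real \<Rightarrow> real"
    assume g: "continuous_on UNIV g" "bounded (range g)"
    then obtain C where "\<And>x. norm (g x) \<le> C"
      by (auto simp: bounded_iff)
    with g show "(\<lambda>n. \<integral>x. g x \<partial>N n) \<longlonglongrightarrow> (\<integral>x. g x \<partial>L)"
      by (intro weak_conv_imp_integral_bdd_continuous_conv[OF assms w])
         (auto simp: continuous_on_eq_continuous_at)
  qed
qed

definition standard_brownian_motion :: "'v measure \<Rightarrow> (real \<Rightarrow> 'v \<Rightarrow> real) \<Rightarrow> bool" where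
  "standard_brownian_motion W B \<longleftrightarrow> prob_space W \<and>
     (\<forall>t\<ge>0. B t \<in> borel_measurable W) \<and>
     (AE \<omega> in W. B 0 \<omega> = 0) \<and>
     (AE \<omega> in W. continuous_on {0..} (\<lambda>t. B t \<omega>)) \<and>
     (\<forall>s t. 0 \<le> s \<and> s < t \<longrightarrow>
        distributed W lborel (\<lambda>\<omega>. B t \<omega> - B s \<omega>) (normal_density 0 (sqrt (t - s)))) \<and>
     (\<forall>(n::nat) \<tau>. 0 \<le> \<tau> 0 \<and> mono \<tau> \<longrightarrow>
        prob_space.indep_vars W (\<lambda>_. borel) (\<lambda>i \<omega>. B (\<tau> (Suc i)) \<omega> - B (\<tau> i) \<omega>) {..<n})"

definition additive_functional ::
    "(real \<Rightarrow> 'w \<Rightarrow> 'a) \<Rightarrow> ('a \<Rightarrow> real) \<Rightarrow> real \<Rightarrow> 'w \<Rightarrow> real" where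
  "additive_functional X f t \<omega> = (LINT s:{0..t}|lborel. f (X s \<omega>))"

definition CLT :: "'w measure \<Rightarrow> (real \<Rightarrow> 'w \<Rightarrow> real) \<Rightarrow> (real \<Rightarrow> real) \<Rightarrow> bool" where
  "CLT P S s \<longleftrightarrow>
     converges_in_law (\<lambda>t. distr P borel (\<lambda>\<omega>. S t \<omega> / s t)) std_normal_distribution at_top"

text \<open>
  The dimension \<open>n\<close> is quantified, so \<open>\<real>\<^sup>n\<close> is represented as the closed subspace of
  \<open>\<real>\<^sup>\<nat>\<close> (product topology and its Borel sets) of the sequences vanishing from index \<open>n\<close> on.
  Bounded continuous functions on it are precisely the restrictions of those on \<open>\<real>\<^sup>\<nat>\<close>. The law
  of the limit does not depend on the choice of the Brownian motion \<open>B\<close>.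
\<close>

definition FCLT ::
    "'w measure \<Rightarrow> (real \<Rightarrow> 'w \<Rightarrow> real) \<Rightarrow> (real \<Rightarrow> real) \<Rightarrow>
     'v measure \<Rightarrow> (real \<Rightarrow> 'v \<Rightarrow> real) \<Rightarrow> bool" where
  "FCLT P S s W B \<longleftrightarrow>
     (\<forall>(n::nat) \<tau>. (\<forall>i<n. 0 < \<tau> i) \<and> (\<forall>i j. i \<le> j \<and> j < n \<longrightarrow> \<tau> i \<le> \<tau> j) \<longrightarrow>
        converges_in_law
          (\<lambda>\<epsilon>. distr P borel (\<lambda>\<omega> i. if i < n then S (\<tau> i / \<epsilon>) \<omega> / s (1 / \<epsilon>) else 0))
          (distr W borel (\<lambda>\<omega> i. if i < n then B (\<tau> i) \<omega> else 0))
          (at_right 0))"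

end

theory Submission
  imports Defs
begin

text \<open>
  Put \<open>t = 1 / \<epsilon>\<close>, let \<open>s\<^sub>t\<close> be the standard deviation of \<open>S\<^sub>t\<close>, and cut the time axis at the
  points \<open>\<sigma>\<^sub>j t\<close>, where \<open>\<sigma>\<^sub>0 = 0\<close> and \<open>\<sigma>\<^sub>1 \<le> \<sigma>\<^sub>2 \<le> \<dots>\<close> are the given times. It is enough to treat the
  increments of \<open>S / s\<^sub>t\<close> over the resulting intervals, because the vector of the values of \<open>S\<close> is
  the image of the vector of the increments under the continuous map of partial sums.

  One increment: the law of the process under the invariant initial distribution is invariant
  under time shifts, by the Markov property, so the increment over \<open>[\<sigma>\<^sub>j t, \<sigma>\<^sub>j\<^sub>+\<^sub>1 t]\<close> has the law
  of \<open>S\<^sub>u\<^sub>t\<close> with \<open>u = \<sigma>\<^sub>j\<^sub>+\<^sub>1 - \<sigma>\<^sub>j\<close> (\<open>path_law_stationary\<close>, \<open>window_integral_law\<close>). Slow variation of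
  \<open>h\<close> means exactly that \<open>s\<^sub>u\<^sub>t / s\<^sub>t\<close> tends to \<open>\<surd>u\<close>. Hence the central limit theorem at time \<open>u t\<close> gives a
  centered normal limit of variance \<open>u\<close> (\<open>marginal_limit\<close>).

  Several increments: adjacent increments are not separated in time, so mixing does not apply to
  them directly. From each one remove an initial piece of length \<open>\<delta> u t\<close>, with \<open>0 < \<delta> < 1\<close>. The
  parts kept are separated by gaps \<open>\<delta> u t\<close> that tend to infinity, so bounded functions of them are
  asymptotically uncorrelated; the part removed has standard deviation \<open>s\<^sub>\<delta>\<^sub>u\<^sub>t\<close>, about \<open>\<surd>(\<delta> u) s\<^sub>t\<close>,
  which is small compared with \<open>s\<^sub>t\<close> when \<open>\<delta>\<close> is small. The gap is taken proportional to \<open>t\<close> so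
  that the same variance ratio controls it. Letting first \<open>t \<rightarrow> \<infinity>\<close> and then \<open>\<delta> \<rightarrow> 0\<close>,
  the expectation of a product of bounded Lipschitz functions of the increments converges to the product of the Gaussian expectations
  (\<open>product_limit\<close>), which is the corresponding expectation for Brownian increments
  (\<open>brownian_product_expectation\<close>).

  From products to all bounded continuous functions: the span of the products is an algebra, dense
  on cubes by the Stone--Weierstrass theorem, and the tails are controlled by the convergence of
  the one-dimensional laws (\<open>expectation_tendsto_of_product_tests\<close>).
\<close>

section \<open>Convergence in law tested on products of Lipschitz functions\<close>

text \<open>
  The Lipschitz property lets test functions absorb errors that are small in \<open>L\<^sup>1\<close>. With values in
  \<open>[0, 1]\<close> the class is closed under products, products of expectations differ by at most the sum
  of the differences of the factors, and the functions are admissible in \<^const>\<open>alpha_mix\<close> as they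
  stand. Scaling and signs are restored by the coefficients in \<open>tensors\<close> below.
\<close>

definition lip_test :: "(real \<Rightarrow> real) \<Rightarrow> bool" where
  "lip_test g \<longleftrightarrow> (\<forall>x. 0 \<le> g x \<and> g x \<le> 1) \<and> (\<exists>L. L-lipschitz_on UNIV g)"

lemma lip_testD:
  assumes "lip_test g"
  shows "0 \<le> g x" "g x \<le> 1" "continuous_on UNIV g" "g \<in> borel_measurable borel"
proof -
  show "0 \<le> g x" "g x \<le> 1" and c: "continuous_on UNIV g"
    using assms by (auto simp: lip_test_def intro: lipschitz_on_continuous_on)
  from c show "g \<in> borel_measurable borel"
    by (rule borel_measurable_continuous_onI)
qed

lemma lip_test_const: "0 \<le> c \<Longrightarrow> c \<le> 1 \<Longrightarrow> lip_test (\<lambda>_. c)"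
  unfolding lip_test_def using lipschitz_on_constant by blast

lemma lip_test_comp:
  assumes "lip_test g" "L-lipschitz_on UNIV \<phi>"
  shows "lip_test (\<lambda>x. g (\<phi> x))"
proof -
  obtain L' where "L'-lipschitz_on UNIV g"
    using assms(1) by (auto simp: lip_test_def)
  then have "(L' * L)-lipschitz_on UNIV (\<lambda>x. g (\<phi> x))"
    by (rule lipschitz_on_compose2[OF assms(2) lipschitz_on_subset[OF _ subset_UNIV]])
  then show ?thesis
    using assms(1) by (auto simp: lip_test_def)
qed

lemma lip_test_mult:
  assumes f: "lip_test f" and g: "lip_test g"
  shows "lip_test (\<lambda>x. f x * g x)"
proof -
  obtain A B where AB: "A-lipschitz_on UNIV f" "B-lipschitz_on UNIV g"
    using f g by (auto simp: lip_test_def)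
  have "(A + B)-lipschitz_on UNIV (\<lambda>x. f x * g x)"
  proof (rule lipschitz_onI)
    show "0 \<le> A + B" using AB by (simp add: lipschitz_on_nonneg)
    fix x y :: real
    have "\<bar>f x * g x - f y * g y\<bar> = \<bar>(f x - f y) * g x + f y * (g x - g y)\<bar>"
      by (simp add: algebra_simps)
    also have "\<dots> \<le> \<bar>f x - f y\<bar> * \<bar>g x\<bar> + \<bar>f y\<bar> * \<bar>g x - g y\<bar>"
      by (metis abs_mult abs_triangle_ineq)
    also have "\<dots> \<le> \<bar>f x - f y\<bar> * 1 + 1 * \<bar>g x - g y\<bar>"
      using lip_testD(1,2)[OF f] lip_testD(1,2)[OF g]
      by (intro add_mono mult_left_mono mult_right_mono) auto
    also have "\<dots> \<le> A * dist x y + B * dist x y"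
      using AB[THEN lipschitz_onD, of x y] by (simp add: dist_real_def)
    finally show "dist (f x * g x) (f y * g y) \<le> (A + B) * dist x y"
      by (simp add: dist_real_def distrib_right)
  qed
  then show ?thesis
    using lip_testD(1,2)[OF f] lip_testD(1,2)[OF g]
    by (auto simp: lip_test_def intro: mult_le_one)
qed

definition clip :: "real \<Rightarrow> real \<Rightarrow> real" where
  "clip K x = max (- K) (min K x)"

lemma clamp_contracts: "\<bar>max a (min b x) - max a (min b y)\<bar> \<le> \<bar>x - y\<bar>" for a b x y :: real
proof -
  have "\<bar>max a x - max a y\<bar> \<le> \<bar>x - y\<bar>" for x y by (simp add: max_def)
  moreover have "\<bar>min b x - min b y\<bar> \<le> \<bar>x - y\<bar>" by (simp add: min_def)
  ultimately show ?thesis by (rule order_trans)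
qed

lemma lipschitz_clip: "1-lipschitz_on UNIV (clip K)"
  by (rule lipschitz_onI) (simp_all add: clip_def dist_real_def clamp_contracts)

lemma lip_test_clip: "0 < K \<Longrightarrow> lip_test (\<lambda>x. (clip K x + K) / (2 * K))"
proof -
  assume K: "0 < K"
  have "(1 / (2 * K))-lipschitz_on UNIV (\<lambda>x. (clip K x + K) / (2 * K))"
    using K lipschitz_onD[OF lipschitz_clip[of K]]
    by (intro lipschitz_onI) (auto simp: dist_real_def field_simps diff_divide_distrib[symmetric])
  moreover have "0 \<le> clip K x + K \<and> clip K x + K \<le> 2 * K" for x
    using K by (auto simp: clip_def)
  ultimately show ?thesis
    using K by (auto simp: lip_test_def)
qed

text \<open>
  A continuous upper bound of the indicator of \<open>{x. K < \<bar>x\<bar>}\<close>: it equals \<open>1\<close> for \<open>\<bar>x\<bar> \<ge> K\<close> and \<open>0\<close> for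
  \<open>\<bar>x\<bar> \<le> K - 1\<close>. Being a test function itself, it turns convergence on test functions into tightness.
\<close>

definition tail_test :: "real \<Rightarrow> real \<Rightarrow> real" where
  "tail_test K x = max 0 (min 1 (\<bar>x\<bar> - (K - 1)))"

lemma lip_test_tail_test: "lip_test (tail_test K)"
proof -
  have "1-lipschitz_on UNIV (tail_test K)"
  proof (rule lipschitz_onI)
    fix x y :: real
    show "dist (tail_test K x) (tail_test K y) \<le> 1 * dist x y"
      unfolding tail_test_def dist_real_def mult_1
      by (rule order_trans[OF clamp_contracts]) (use abs_triangle_ineq3[of x y] in simp)
  qed simp
  then show ?thesis by (auto simp: lip_test_def tail_test_def)
qed

text \<open>
  The linear span of the products of test functions of the first \<open>n\<close> coordinates, given by the two
  rules that make every linear property of its elements an induction.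
\<close>

inductive_set tensors :: "nat \<Rightarrow> ((nat \<Rightarrow> real) \<Rightarrow> real) set" for n where
  prod: "(\<And>j. lip_test (g j)) \<Longrightarrow> (\<lambda>y. c * (\<Prod>j<n. g j (y j))) \<in> tensors n"
| add: "p \<in> tensors n \<Longrightarrow> q \<in> tensors n \<Longrightarrow> (\<lambda>y. p y + q y) \<in> tensors n"

lemma tensors_mult:
  assumes "p \<in> tensors n" "q \<in> tensors n"
  shows "(\<lambda>y. p y * q y) \<in> tensors n"
  using assms(1)
proof induction
  case (prod g c)
  from assms(2) show ?case
  proof induction
    case (prod g' c')
    have "(\<lambda>y. (c * c') * (\<Prod>j<n. g j (y j) * g' j (y j))) \<in> tensors n"
      using \<open>\<And>j. lip_test (g j)\<close> prod by (intro tensors.prod lip_test_mult)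
    then show ?case by (simp add: prod.distrib mult_ac)
  next
    case (add p q)
    then show ?case using tensors.add[OF add.IH] by (simp add: distrib_left)
  qed
next
  case (add p p')
  then show ?case using tensors.add[OF add.IH] by (simp add: distrib_right)
qed

lemma tensors_const: "(\<lambda>_. c) \<in> tensors n"
  using tensors.prod[of "\<lambda>_ _. 1" c n] lip_test_const[of 1] by simp

lemma tensors_coordinate:
  assumes g: "lip_test g" and j: "j < n"
  shows "(\<lambda>y. g (y j)) \<in> tensors n"
proof -
  have "(\<lambda>y. 1 * (\<Prod>i<n. (if i = j then g else (\<lambda>_. 1)) (y i))) \<in> tensors n"
    using g by (intro tensors.prod) (auto simp: lip_test_const)
  moreover have "(\<Prod>i<n. (if i = j then g else (\<lambda>_. 1)) (y i)) = g (y j)" for y :: "nat \<Rightarrow> real"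
    using j by (simp add: if_distribR prod.delta cong: if_cong)
  ultimately show ?thesis by simp
qed

text \<open>
  Clipping the arguments makes an approximation on a cube uniformly bounded on the whole space
  without leaving the span.
\<close>

lemma tensors_clip:
  "p \<in> tensors n \<Longrightarrow> (\<lambda>y. p (\<lambda>j. clip K (y j))) \<in> tensors n"
proof (induction rule: tensors.induct)
  case (prod g c)
  show ?case
    by (rule tensors.prod[where g = "\<lambda>j x. g j (clip K x)"]) (rule lip_test_comp[OF prod lipschitz_clip])
qed (rule tensors.add)

lemma tensors_continuous: "p \<in> tensors n \<Longrightarrow> continuous_on UNIV p"
proof (induction rule: tensors.induct)
  case (prod g c)
  have "continuous_on UNIV (\<lambda>y. g j (y j))" for j
    by (rule continuous_on_compose2[OF lip_testD(3)[OF prod]]) auto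
  then show ?case by (intro continuous_intros)
qed (rule continuous_on_add)

lemma tensors_bounded: "p \<in> tensors n \<Longrightarrow> \<exists>C. \<forall>y. \<bar>p y\<bar> \<le> C"
proof (induction rule: tensors.induct)
  case (prod g c)
  have "\<bar>c * (\<Prod>j<n. g j (y j))\<bar> \<le> \<bar>c\<bar>" for y :: "nat \<Rightarrow> real"
  proof -
    have "(\<Prod>j<n. g j (y j)) \<le> 1" "0 \<le> (\<Prod>j<n. g j (y j))"
      using lip_testD(1,2)[OF prod] by (auto intro!: prod_le_1 prod_nonneg)
    then show ?thesis by (simp add: abs_mult mult_left_le)
  qed
  then show ?case by blast
next
  case (add p q)
  then obtain C D where "\<forall>y. \<bar>p y\<bar> \<le> C" "\<forall>y. \<bar>q y\<bar> \<le> D" by blast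
  then have "\<forall>y. \<bar>p y + q y\<bar> \<le> C + D"
    by (meson abs_triangle_ineq add_mono order_trans)
  then show ?case by blast
qed

lemma compact_box: "compact {y :: nat \<Rightarrow> real. (\<forall>j<n. \<bar>y j\<bar> \<le> K) \<and> (\<forall>j\<ge>n. y j = 0)}"
proof -
  let ?S = "\<lambda>j. if j < n then {-K..K} else {0}"
  have "compactin (product_topology (\<lambda>_. euclidean) UNIV) (PiE UNIV ?S)"
    by (subst compactin_PiE) auto
  moreover have "PiE UNIV ?S = {y :: nat \<Rightarrow> real. (\<forall>j<n. \<bar>y j\<bar> \<le> K) \<and> (\<forall>j\<ge>n. y j = 0)}"
    by (auto simp: PiE_iff abs_le_iff split: if_splits) (smt (verit))+
  ultimately show ?thesis
    by (simp add: euclidean_product_topology)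
qed

text \<open>
  Stone--Weierstrass on the cube: affinely rescaled clipped coordinates are test functions and
  separate its points.
\<close>

lemma tensors_dense:
  fixes g :: "(nat \<Rightarrow> real) \<Rightarrow> real"
  assumes g: "continuous_on UNIV g" and e: "0 < e" and K: "0 < K"
  shows "\<exists>p\<in>tensors n. \<forall>y. (\<forall>j<n. \<bar>y j\<bar> \<le> K) \<and> (\<forall>j\<ge>n. y j = 0) \<longrightarrow> \<bar>g y - p y\<bar> < e"
proof -
  let ?S = "{y :: nat \<Rightarrow> real. (\<forall>j<n. \<bar>y j\<bar> \<le> K) \<and> (\<forall>j\<ge>n. y j = 0)}"
  interpret function_ring_on "tensors n" ?S
  proof
    show "continuous_on ?S p" if "p \<in> tensors n" for p
      using tensors_continuous[OF that] by (rule continuous_on_subset) auto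
    fix x y assume x: "x \<in> ?S" and y: "y \<in> ?S" and "x \<noteq> y"
    then obtain j where j: "x j \<noteq> y j" by (meson ext)
    with x y have "j < n" by (metis (mono_tags, lifting) mem_Collect_eq not_le)
    have "clip K (x j) = x j" "clip K (y j) = y j"
      using x y \<open>j < n\<close> by (auto simp: clip_def abs_le_iff)
    with j K have "(clip K (x j) + K) / (2 * K) \<noteq> (clip K (y j) + K) / (2 * K)" by simp
    then show "\<exists>f\<in>tensors n. f x \<noteq> f y"
      by (rule bexI[OF _ tensors_coordinate[OF lip_test_clip[OF K] \<open>j < n\<close>]])
  next
    show "compact ?S" by (rule compact_box)
    show "(\<lambda>_. c) \<in> tensors n" for c by (rule tensors_const)
    show "(\<lambda>x. p x + q x) \<in> tensors n" "(\<lambda>x. p x * q x) \<in> tensors n"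
      if "p \<in> tensors n" "q \<in> tensors n" for p q
      using that by (rule tensors.add, rule tensors_mult)
  qed
  have "continuous_on ?S g" using g by (rule continuous_on_subset) auto
  from Stone_Weierstrass_basic[OF this e] show ?thesis by blast
qed

lemma (in prob_space) integrable_lip_test:
  assumes g: "lip_test g" and [measurable]: "X \<in> borel_measurable M"
  shows "integrable M (\<lambda>\<omega>. g (X \<omega>))"
proof -
  note lip_testD(4)[OF g, measurable]
  show ?thesis
    using lip_testD(1,2)[OF g] by (intro integrable_const_bound[of _ 1]) auto
qed

lemma (in prob_space) tail_test_small:
  assumes [measurable]: "Y \<in> borel_measurable M" and e: "0 < e"
  shows "\<forall>\<^sub>F K in at_top. expectation (\<lambda>\<omega>. tail_test K (Y \<omega>)) < e"
proof -
  have [measurable]: "tail_test K \<in> borel_measurable borel" for K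
    using lip_testD(4)[OF lip_test_tail_test] .
  have "((\<lambda>K. expectation (\<lambda>\<omega>. tail_test K (Y \<omega>))) \<longlongrightarrow> expectation (\<lambda>_. 0)) at_top"
  proof (rule integral_dominated_convergence_at_top[where w = "\<lambda>_. 1"])
    show "\<forall>\<^sub>F K in at_top. AE \<omega> in M. norm (tail_test K (Y \<omega>)) \<le> 1"
      by (simp add: tail_test_def)
    have "\<forall>\<^sub>F K in at_top. tail_test K x = 0" for x
      using eventually_ge_at_top[of "\<bar>x\<bar> + 1"]
      by eventually_elim (auto simp: tail_test_def)
    then show "AE \<omega> in M. ((\<lambda>K. tail_test K (Y \<omega>)) \<longlongrightarrow> 0) at_top"
      by (auto intro: tendsto_eventually)
  qed auto
  then show ?thesis using e by (auto dest: order_tendstoD(2))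
qed

text \<open>
  Choose a cube outside which the limit \<open>Y\<close> has little mass and approximate \<open>g\<close> on it by an element
  \<open>p\<close> of the span. Replacing \<open>p\<close> by its clipped version \<open>q\<close>, the error \<open>\<bar>g - q\<bar>\<close> is small on the cube and
  bounded by a multiple of the tail functions elsewhere. Both \<open>q\<close> and the tail functions
  belong to the span, so their expectations converge by assumption.
\<close>

lemma expectation_tendsto_of_product_tests:
  fixes Z :: "'i \<Rightarrow> 'a \<Rightarrow> nat \<Rightarrow> real" and Y :: "'b \<Rightarrow> nat \<Rightarrow> real"
    and g :: "(nat \<Rightarrow> real) \<Rightarrow> real"
  assumes P: "prob_space P" and W: "prob_space W"
    and Z [measurable]: "\<And>i j. (\<lambda>\<omega>. Z i \<omega> j) \<in> borel_measurable P"
    and Y [measurable]: "\<And>j. (\<lambda>\<omega>. Y \<omega> j) \<in> borel_measurable W"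
    and Z0: "\<And>i \<omega> j. n \<le> j \<Longrightarrow> Z i \<omega> j = 0" and Y0: "\<And>\<omega> j. n \<le> j \<Longrightarrow> Y \<omega> j = 0"
    and lim: "\<And>t. (\<And>j. lip_test (t j)) \<Longrightarrow>
        ((\<lambda>i. \<integral>\<omega>. (\<Prod>j<n. t j (Z i \<omega> j)) \<partial>P) \<longlongrightarrow> (\<integral>\<omega>. (\<Prod>j<n. t j (Y \<omega> j)) \<partial>W)) F"
    and g: "continuous_on UNIV g" "bounded (range g)"
  shows "((\<lambda>i. \<integral>\<omega>. g (Z i \<omega>) \<partial>P) \<longlongrightarrow> (\<integral>\<omega>. g (Y \<omega>) \<partial>W)) F"
proof -
  interpret P: prob_space P by fact
  interpret W: prob_space W by fact
  have Zm [measurable]: "Z i \<in> borel_measurable P" for i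
    by (rule measurable_coordinatewise_then_product) measurable
  have Ym [measurable]: "Y \<in> borel_measurable W"
    by (rule measurable_coordinatewise_then_product) measurable
  have cont_int: "integrable P (\<lambda>\<omega>. p (Z i \<omega>))" "integrable W (\<lambda>\<omega>. p (Y \<omega>))"
    if "continuous_on UNIV p" "\<And>y. \<bar>p y\<bar> \<le> C" for p :: "(nat \<Rightarrow> real) \<Rightarrow> real" and i and C :: real
  proof -
    have [measurable]: "p \<in> borel_measurable borel"
      using that(1) by (rule borel_measurable_continuous_onI)
    show "integrable P (\<lambda>\<omega>. p (Z i \<omega>))" "integrable W (\<lambda>\<omega>. p (Y \<omega>))"
      using that(2) by (auto intro!: P.integrable_const_bound[of _ C] W.integrable_const_bound[of _ C])
  qed
  have tensor_int: "integrable P (\<lambda>\<omega>. p (Z i \<omega>))" "integrable W (\<lambda>\<omega>. p (Y \<omega>))"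
    if p: "p \<in> tensors n" for p i
    using tensors_bounded[OF p] cont_int[OF tensors_continuous[OF p]] by auto
  have tensor_lim: "((\<lambda>i. \<integral>\<omega>. p (Z i \<omega>) \<partial>P) \<longlongrightarrow> (\<integral>\<omega>. p (Y \<omega>) \<partial>W)) F" if "p \<in> tensors n" for p
    using that
  proof induction
    case (prod t c)
    then show ?case using tendsto_mult_left[OF lim[OF prod], of c] by simp
  next
    case (add p q)
    then show ?case using tendsto_add[OF add.IH] by (simp add: tensor_int)
  qed
  obtain C where C: "\<And>y. \<bar>g y\<bar> \<le> C" "0 \<le> C"
    using g(2) by (auto simp: bounded_iff) (metis abs_ge_zero order_trans)
  show ?thesis
  proof (rule tendstoI)
    fix e :: real assume e: "0 < e"
    \<comment> \<open>The total error below is at most \<open>(3 + (2 C + 1) (2 n)) d\<close>: one \<open>d\<close> for each of the two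
      approximations of \<open>g\<close>, one for the convergence of \<open>q\<close>, and \<open>n\<close> tails on either side.\<close>
    define d where "d = e / (3 * (3 + (2 * C + 1) * (2 * real n)))"
    have D0: "0 < 3 * (3 + (2 * C + 1) * (2 * real n))"
      using C(2) by (simp add: add_pos_nonneg)
    have d: "0 < d" unfolding d_def using e D0 by (rule divide_pos_pos)
    have dd: "(3 + (2 * C + 1) * (2 * real n)) * d < e"
    proof -
      have "3 * ((3 + (2 * C + 1) * (2 * real n)) * d) = e"
        unfolding d_def using D0 by (simp add: field_simps)
      then show ?thesis using e by linarith
    qed
    \<comment> \<open>The bound by \<open>1\<close> serves outside the cube, where \<open>\<bar>g - q\<bar> \<le> 2 C + 1\<close> is used.\<close>
    define d1 where "d1 = min d 1"
    have d1: "0 < d1" "d1 \<le> d" "d1 \<le> 1" using d by (auto simp: d1_def)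
    have "\<forall>\<^sub>F K in at_top. 0 < K \<and> (\<forall>j\<in>{..<n}. W.expectation (\<lambda>\<omega>. tail_test K (Y \<omega> j)) < d)"
      by (intro eventually_conj eventually_gt_at_top eventually_ball_finite ballI W.tail_test_small)
         (auto simp: d)
    then obtain K where K: "0 < K" and tailY: "\<And>j. j < n \<Longrightarrow> W.expectation (\<lambda>\<omega>. tail_test K (Y \<omega> j)) < d"
      by (auto dest!: eventually_happens simp: trivial_limit_at_top_linorder)
    obtain p where p: "p \<in> tensors n"
      and pg: "\<And>y. (\<And>j. j < n \<Longrightarrow> \<bar>y j\<bar> \<le> K) \<Longrightarrow> (\<And>j. n \<le> j \<Longrightarrow> y j = 0) \<Longrightarrow> \<bar>g y - p y\<bar> < d1"
      using tensors_dense[OF g(1) d1(1) K, of n] by blast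
    define q where "q y = p (\<lambda>j. clip K (y j))" for y
    have q: "q \<in> tensors n" unfolding q_def by (rule tensors_clip[OF p])
    have tail: "(\<lambda>y. tail_test K (y j)) \<in> tensors n" if "j < n" for j
      using that by (rule tensors_coordinate[OF lip_test_tail_test])
    have gq: "\<bar>g y - q y\<bar> \<le> d + (2 * C + 1) * (\<Sum>j<n. tail_test K (y j))"
      if y: "\<And>j. n \<le> j \<Longrightarrow> y j = 0" for y
    proof (cases "\<forall>j<n. \<bar>y j\<bar> \<le> K")
      case True
      then have "clip K (y j) = y j" for j
        using y[of j] K by (cases "j < n") (auto simp: clip_def abs_le_iff)
      then have "\<bar>g y - q y\<bar> \<le> d" using pg[of y] True y d1 by (force simp: q_def)
      moreover have "0 \<le> (2 * C + 1) * (\<Sum>j<n. tail_test K (y j))"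
        using C(2) by (intro mult_nonneg_nonneg sum_nonneg) (auto simp: tail_test_def)
      ultimately show ?thesis by linarith
    next
      case False
      then obtain i where i: "i < n" "K < \<bar>y i\<bar>" by auto
      \<comment> \<open>The clipped point lies in the cube, so \<open>q\<close> inherits the bound \<open>C + 1\<close> there.\<close>
      have "\<bar>g (\<lambda>j. clip K (y j)) - q y\<bar> < d1"
        unfolding q_def using K y by (intro pg) (auto simp: clip_def)
      with C(1)[of y] C(1)[of "\<lambda>j. clip K (y j)"] d1 have "\<bar>g y - q y\<bar> \<le> 2 * C + 1" by linarith
      also have "\<dots> \<le> (2 * C + 1) * (\<Sum>j<n. tail_test K (y j))"
      proof -
        have "1 = tail_test K (y i)" using i by (simp add: tail_test_def)
        also have "\<dots> \<le> (\<Sum>j<n. tail_test K (y j))"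
          using i by (intro member_le_sum) (auto simp: tail_test_def)
        finally show ?thesis using C(2) mult_left_mono[of 1 _ "2 * C + 1"] by simp
      qed
      finally show ?thesis using d by linarith
    qed
    have ZP: "\<bar>(\<integral>\<omega>. g (Z i \<omega>) \<partial>P) - (\<integral>\<omega>. q (Z i \<omega>) \<partial>P)\<bar>
        \<le> d + (2 * C + 1) * (\<Sum>j<n. \<integral>\<omega>. tail_test K (Z i \<omega> j) \<partial>P)" for i
    proof -
      have "\<bar>(\<integral>\<omega>. g (Z i \<omega>) \<partial>P) - (\<integral>\<omega>. q (Z i \<omega>) \<partial>P)\<bar> = \<bar>\<integral>\<omega>. g (Z i \<omega>) - q (Z i \<omega>) \<partial>P\<bar>"
        using cont_int(1)[OF g(1) C(1)] tensor_int(1)[OF q] by simp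
      also have "\<dots> \<le> (\<integral>\<omega>. \<bar>g (Z i \<omega>) - q (Z i \<omega>)\<bar> \<partial>P)" by (rule integral_abs_bound)
      also have "\<dots> \<le> (\<integral>\<omega>. d + (2 * C + 1) * (\<Sum>j<n. tail_test K (Z i \<omega> j)) \<partial>P)"
        using cont_int(1)[OF g(1) C(1)] tensor_int(1)[OF q] tensor_int(1)[OF tail] Z0
        by (intro integral_mono gq integrable_abs Bochner_Integration.integrable_diff
            Bochner_Integration.integrable_add integrable_mult_right Bochner_Integration.integrable_sum) auto
      also have "\<dots> = d + (2 * C + 1) * (\<Sum>j<n. \<integral>\<omega>. tail_test K (Z i \<omega> j) \<partial>P)"
        by (subst Bochner_Integration.integral_add)
           (auto simp: P.prob_space tensor_int(1)[OF tail])
      finally show ?thesis .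
    qed
    have YW: "\<bar>(\<integral>\<omega>. g (Y \<omega>) \<partial>W) - (\<integral>\<omega>. q (Y \<omega>) \<partial>W)\<bar>
        \<le> d + (2 * C + 1) * (\<Sum>j<n. \<integral>\<omega>. tail_test K (Y \<omega> j) \<partial>W)"
    proof -
      have "\<bar>(\<integral>\<omega>. g (Y \<omega>) \<partial>W) - (\<integral>\<omega>. q (Y \<omega>) \<partial>W)\<bar> = \<bar>\<integral>\<omega>. g (Y \<omega>) - q (Y \<omega>) \<partial>W\<bar>"
        using cont_int(2)[OF g(1) C(1)] tensor_int(2)[OF q] by simp
      also have "\<dots> \<le> (\<integral>\<omega>. \<bar>g (Y \<omega>) - q (Y \<omega>)\<bar> \<partial>W)" by (rule integral_abs_bound)
      also have "\<dots> \<le> (\<integral>\<omega>. d + (2 * C + 1) * (\<Sum>j<n. tail_test K (Y \<omega> j)) \<partial>W)"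
        using cont_int(2)[OF g(1) C(1)] tensor_int(2)[OF q] tensor_int(2)[OF tail] Y0
        by (intro integral_mono gq integrable_abs Bochner_Integration.integrable_diff
            Bochner_Integration.integrable_add integrable_mult_right Bochner_Integration.integrable_sum) auto
      also have "\<dots> = d + (2 * C + 1) * (\<Sum>j<n. \<integral>\<omega>. tail_test K (Y \<omega> j) \<partial>W)"
        by (subst Bochner_Integration.integral_add)
           (auto simp: W.prob_space tensor_int(2)[OF tail])
      finally show ?thesis .
    qed
    have ev1: "\<forall>\<^sub>F i in F. \<bar>(\<integral>\<omega>. q (Z i \<omega>) \<partial>P) - (\<integral>\<omega>. q (Y \<omega>) \<partial>W)\<bar> < d"
      using tendstoD[OF tensor_lim[OF q] d] by (simp add: dist_real_def)
    have ev2: "\<forall>\<^sub>F i in F. \<forall>j\<in>{..<n}. (\<integral>\<omega>. tail_test K (Z i \<omega> j) \<partial>P) < d"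
      using order_tendstoD(2)[OF tensor_lim[OF tail] tailY] by (intro eventually_ball_finite) auto
    have tY: "(\<Sum>j<n. \<integral>\<omega>. tail_test K (Y \<omega> j) \<partial>W) \<le> real n * d"
      using sum_bounded_above[of "{..<n}" "\<lambda>j. \<integral>\<omega>. tail_test K (Y \<omega> j) \<partial>W" d] tailY
      by (auto intro: less_imp_le)
    show "\<forall>\<^sub>F i in F. dist (\<integral>\<omega>. g (Z i \<omega>) \<partial>P) (\<integral>\<omega>. g (Y \<omega>) \<partial>W) < e"
      using ev1 ev2
    proof eventually_elim
      case (elim i)
      have tZ: "(\<Sum>j<n. \<integral>\<omega>. tail_test K (Z i \<omega> j) \<partial>P) \<le> real n * d"
        using sum_bounded_above[of "{..<n}" "\<lambda>j. \<integral>\<omega>. tail_test K (Z i \<omega> j) \<partial>P" d] elim(2)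
        by (auto intro: less_imp_le)
      have "\<bar>(\<integral>\<omega>. g (Z i \<omega>) \<partial>P) - (\<integral>\<omega>. g (Y \<omega>) \<partial>W)\<bar>
          \<le> (d + (2 * C + 1) * (real n * d)) + d + (d + (2 * C + 1) * (real n * d))"
        using ZP[of i] YW elim(1) mult_left_mono[OF tZ, of "2 * C + 1"] mult_left_mono[OF tY, of "2 * C + 1"] C(2)
        by linarith
      also have "\<dots> = (3 + (2 * C + 1) * (2 * real n)) * d" by (simp add: algebra_simps)
      finally show ?case using dd by (simp add: dist_real_def)
    qed
  qed
qed

section \<open>Shift invariance of a Markov process started from its invariant law\<close>

lemma measurable_past:
  fixes X :: "real \<Rightarrow> 'w \<Rightarrow> 'a::topological_space"
  assumes "0 \<le> u" "ennreal u \<le> t"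
  shows "X u \<in> borel_measurable (past P X t)"
proof (rule measurableI)
  fix A :: "'a set" assume "A \<in> sets borel"
  then show "X u -` A \<inter> space (past P X t) \<in> sets (past P X t)"
    unfolding past_def using assms
    by (subst space_measure_of, blast, subst sets_measure_of, blast) (intro sigma_sets.Basic, blast)
qed simp

lemma measurable_future:
  fixes X :: "real \<Rightarrow> 'w \<Rightarrow> 'a::topological_space"
  assumes "0 \<le> u" "t \<le> u"
  shows "X u \<in> borel_measurable (future P X t)"
proof (rule measurableI)
  fix A :: "'a set" assume "A \<in> sets borel"
  then show "X u -` A \<inter> space (future P X t) \<in> sets (future P X t)"
    unfolding future_def using assms
    by (subst space_measure_of, blast, subst sets_measure_of, blast) (intro sigma_sets.Basic, blast)
qed simp

lemma space_past [simp]: "space (past P X t) = space P"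
  unfolding past_def by (intro space_measure_of) auto

lemma space_future [simp]: "space (future P X t) = space P"
  unfolding future_def by (intro space_measure_of) auto

lemma sets_past_subset:
  assumes "\<And>u. 0 \<le> u \<Longrightarrow> X u \<in> borel_measurable P"
  shows "sets (past P X t) \<subseteq> sets P"
  unfolding past_def using assms
  by (subst sets_measure_of, blast) (intro sets.sigma_sets_subset, auto intro: measurable_sets)

context diffusion
begin

lemma kernel [measurable]: "Q \<in> borel \<rightarrow>\<^sub>M subprob_algebra M"
  using kernel_Q by (rule measurable_prob_algebraD)

lemma prob_space_Q: "prob_space (Q x)" and sets_Q [measurable_cong]: "sets (Q x) = sets M"
  using measurable_space[OF kernel_Q, of x] by (auto simp: space_prob_algebra)

lemma space_Q: "space (Q x) = space M"
  using sets_Q by (rule sets_eq_imp_space_eq)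

lemma semigroup_op_measurable [measurable]:
  assumes "0 \<le> t" and g: "g \<in> borel_measurable borel"
  shows "semigroup_op X Q t g \<in> borel_measurable borel"
  unfolding semigroup_op_def using assms
  by (intro measurable_compose[OF kernel integral_measurable_subprob_algebra]
      measurable_compose[OF measurable_X g])

text \<open>
  A constant is a stopping time, and the sets of its pre-\<open>\<sigma>\<close>-algebra are exactly those of the past
  up to that time; thus the strong Markov property at a constant time gives the simple Markov property, here
  integrated against a bounded function of the past.
\<close>

lemma markov_property:
  assumes s: "0 \<le> s" and t: "0 \<le> t"
    and F: "F \<in> borel_measurable (past M X (ennreal s))" and FC: "\<And>\<omega>. \<bar>F \<omega>\<bar> \<le> C"
    and g [measurable]: "g \<in> borel_measurable borel" and gD: "\<And>x. \<bar>g x\<bar> \<le> D"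
  shows "(\<integral>\<omega>. F \<omega> * g (X (s + t) \<omega>) \<partial>Q x) = (\<integral>\<omega>. F \<omega> * semigroup_op X Q t g (X s \<omega>) \<partial>Q x)"
proof -
  interpret prob_space "Q x" by (rule prob_space_Q)
  define A where "A = filtration.pre_sigma (space M) (past M X) (\<lambda>_. ennreal s)"
  have setsA: "sets A = {B. \<forall>t. {\<omega>\<in>B. ennreal s \<le> t} \<in> sets (past M X t)}"
    unfolding A_def by (rule filtration.sets_pre_sigma[OF filtration_past stopping_time_const])
  have spaceA: "space A = space M"
    unfolding A_def by (rule filtration.space_pre_sigma[OF filtration_past])
  have past_M: "sets (past M X t) \<subseteq> sets M" for t
    by (rule sets_past_subset) (rule measurable_X)
  have "sets A \<subseteq> sets M"
  proof
    fix B assume "B \<in> sets A"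
    then have "{\<omega>\<in>B. ennreal s \<le> ennreal s} \<in> sets (past M X (ennreal s))"
      unfolding setsA by blast
    then show "B \<in> sets M" using subsetD[OF past_M] by simp
  qed
  then interpret finite_measure_subalgebra "Q x" A
    by unfold_locales (simp add: subalgebra_def spaceA space_Q sets_Q)
  have "sets (past M X (ennreal s)) \<subseteq> sets A"
  proof
    fix B assume B: "B \<in> sets (past M X (ennreal s))"
    have "{\<omega>\<in>B. ennreal s \<le> t} \<in> sets (past M X t)" for t
    proof (cases "ennreal s \<le> t")
      case True
      then have "{\<omega>\<in>B. ennreal s \<le> t} = B" by simp
      then show ?thesis
        using subsetD[OF filtration.sets_F_mono[OF filtration_past True] B] by simp
    qed simp
    then show "B \<in> sets A" unfolding setsA by blast
  qed
  then have FA: "F \<in> borel_measurable A"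
    by (intro measurable_from_subalg[OF _ F]) (simp add: subalgebra_def spaceA)
  have [measurable]: "X (s + t) \<in> borel_measurable M" "X s \<in> borel_measurable M"
    using s t by (auto intro: measurable_X)
  have Fm [measurable]: "F \<in> borel_measurable M"
    using F by (rule measurable_from_subalg[rotated]) (simp add: subalgebra_def past_M)
  let ?G = "\<lambda>\<omega>. g (X (s + t) \<omega>)"
  have "AE \<omega> in Q x. real_cond_exp (Q x) A
           (\<lambda>\<omega>. if ennreal s < \<infinity> then g (X (enn2real (ennreal s) + t) \<omega>) else 0) \<omega>
         = (if ennreal s < \<infinity> then semigroup_op X Q t g (X (enn2real (ennreal s)) \<omega>) else 0)"
    using gD strong_markov[unfolded strong_markov_def, rule_format,
        OF stopping_time_const t g, of x "ennreal s"]
    unfolding A_def by (auto simp: bounded_iff)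
  then have AE: "AE \<omega> in Q x. real_cond_exp (Q x) A ?G \<omega> = semigroup_op X Q t g (X s \<omega>)"
    using s by simp
  note semigroup_op_measurable[OF t g, measurable]
  have int: "integrable (Q x) (\<lambda>\<omega>. F \<omega> * ?G \<omega>)"
    using mult_mono'[OF FC gD] by (intro integrable_const_bound[of _ "C * D"]) (auto simp: abs_mult)
  have "(\<integral>\<omega>. F \<omega> * ?G \<omega> \<partial>Q x) = (\<integral>\<omega>. F \<omega> * real_cond_exp (Q x) A ?G \<omega> \<partial>Q x)"
    by (rule real_cond_exp_intg(2)[OF int FA, symmetric]) simp
  also have "\<dots> = (\<integral>\<omega>. F \<omega> * semigroup_op X Q t g (X s \<omega>) \<partial>Q x)"
    using AE by (intro integral_cong_AE) auto
  finally show ?thesis .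
qed

lemma semigroup_op_bound:
  assumes "0 \<le> t" and g [measurable]: "g \<in> borel_measurable borel" and C: "\<And>x. \<bar>g x\<bar> \<le> C"
  shows "\<bar>semigroup_op X Q t g x\<bar> \<le> C"
proof -
  interpret prob_space "Q x" by (rule prob_space_Q)
  have [measurable]: "X t \<in> borel_measurable M" using assms by (intro measurable_X)
  have "\<bar>\<integral>\<omega>. g (X t \<omega>) \<partial>Q x\<bar> \<le> (\<integral>\<omega>. \<bar>g (X t \<omega>)\<bar> \<partial>Q x)" by (rule integral_abs_bound)
  also have "\<dots> \<le> (\<integral>\<omega>. C \<partial>Q x)"
    using C order_trans[OF abs_ge_zero C]
    by (intro integral_mono integrable_abs integrable_const_bound[of _ C]) auto
  finally show ?thesis by (simp add: semigroup_op_def prob_space)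
qed

end

context ergodic_diffusion
begin

definition P\<^sub>\<mu> where "P\<^sub>\<mu> = \<mu> \<bind> Q"

lemma prob_space_mu: "prob_space \<mu>" and sets_mu [measurable_cong]: "sets \<mu> = sets borel"
  using invariant by (auto simp: invariant_prob_def)

lemma kernel_mu [measurable]: "Q \<in> \<mu> \<rightarrow>\<^sub>M subprob_algebra M"
  using kernel by (simp add: measurable_cong_sets[OF sets_mu refl])

lemma space_mu: "space \<mu> = UNIV"
  using sets_eq_imp_space_eq[OF sets_mu] by simp

lemma sets_P [measurable_cong]: "sets P\<^sub>\<mu> = sets M"
  unfolding P\<^sub>\<mu>_def by (rule sets_bind) (simp_all add: sets_Q space_mu)

lemma space_P: "space P\<^sub>\<mu> = space M"
  using sets_P by (rule sets_eq_imp_space_eq)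

lemma prob_space_P: "prob_space P\<^sub>\<mu>"
  unfolding P\<^sub>\<mu>_def using prob_space_mu
  by (rule prob_space.prob_space_bind[where S = M]) (simp_all add: prob_space_Q)

lemma integral_P:
  fixes F :: "_ \<Rightarrow> real"
  assumes "F \<in> borel_measurable M" "\<And>\<omega>. \<bar>F \<omega>\<bar> \<le> C"
  shows "(\<integral>\<omega>. F \<omega> \<partial>P\<^sub>\<mu>) = (\<integral>x. (\<integral>\<omega>. F \<omega> \<partial>Q x) \<partial>\<mu>)"
  unfolding P\<^sub>\<mu>_def
proof (rule integral_bind[OF _ _ kernel_mu])
  show "finite_measure \<mu>" using prob_space_mu by (rule prob_space.finite_measure)
  show "AE x in \<mu>. emeasure (Q x) (space (Q x)) \<le> ennreal 1"
    using prob_space.emeasure_space_1[OF prob_space_Q] by simp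
qed (use assms in auto)

lemma markov_property_P:
  assumes s: "0 \<le> s" and t: "0 \<le> t"
    and F: "F \<in> borel_measurable (past M X (ennreal s))" and FC: "\<And>\<omega>. \<bar>F \<omega>\<bar> \<le> C"
    and g [measurable]: "g \<in> borel_measurable borel" and gD: "\<And>x. \<bar>g x\<bar> \<le> D"
  shows "(\<integral>\<omega>. F \<omega> * g (X (s + t) \<omega>) \<partial>P\<^sub>\<mu>) = (\<integral>\<omega>. F \<omega> * semigroup_op X Q t g (X s \<omega>) \<partial>P\<^sub>\<mu>)"
proof -
  have [measurable]: "X (s + t) \<in> borel_measurable M" "X s \<in> borel_measurable M"
    using s t by (auto intro: measurable_X)
  have [measurable]: "F \<in> borel_measurable M"
    using F by (rule measurable_from_subalg[rotated])
      (simp add: subalgebra_def sets_past_subset[OF measurable_X])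
  note semigroup_op_measurable[OF t g, measurable]
  have "\<bar>F \<omega> * g y\<bar> \<le> C * D" "\<bar>F \<omega> * semigroup_op X Q t g y\<bar> \<le> C * D" for \<omega> y
    using mult_mono'[OF FC gD] mult_mono'[OF FC semigroup_op_bound[OF t g gD]]
    by (auto simp: abs_mult)
  then show ?thesis
    by (subst (1 2) integral_P[where C = "C * D"]) (simp_all add: markov_property[OF assms])
qed

lemma marginal_P:
  assumes "0 \<le> t" shows "distr P\<^sub>\<mu> borel (X t) = \<mu>"
proof -
  have "distr P\<^sub>\<mu> borel (X t) = \<mu> \<bind> (\<lambda>x. distr (Q x) borel (X t))"
    unfolding P\<^sub>\<mu>_def by (rule distr_bind[OF kernel_mu]) (auto simp: space_mu measurable_X assms)
  also have "\<dots> = \<mu>" using invariant assms by (simp add: invariant_prob_def)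
  finally show ?thesis .
qed

lemma integral_marginal_P:
  fixes g :: "_ \<Rightarrow> real"
  assumes "0 \<le> t" "g \<in> borel_measurable borel"
  shows "(\<integral>\<omega>. g (X t \<omega>) \<partial>P\<^sub>\<mu>) = (\<integral>x. g x \<partial>\<mu>)"
  using integral_distr[of "X t" P\<^sub>\<mu> borel g] measurable_X[OF assms(1)] assms
  by (simp add: marginal_P measurable_cong_sets[OF sets_P refl])

text \<open>
  Induction on the largest time \<open>b\<close>. With \<open>m\<close> the preceding time, the Markov property replaces the
  factor at time \<open>b\<close> by \<open>semigroup_op X Q (b - m) (g b)\<close> evaluated at time \<open>m\<close>, and this function does
  not depend on the shift. It is absorbed in the factor at time \<open>m\<close>, which is why the functions \<open>g\<close> must be
  general and not just indicators. A single time is invariance of \<open>\<mu>\<close>.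
\<close>

lemma finite_dimensional_stationarity:
  assumes "finite J" "J \<subseteq> {0..}" and a: "0 \<le> a"
    and "\<And>j. g j \<in> borel_measurable borel" "\<And>j x. \<bar>g j x\<bar> \<le> (1::real)"
  shows "(\<integral>\<omega>. (\<Prod>j\<in>J. g j (X (a + j) \<omega>)) \<partial>P\<^sub>\<mu>) = (\<integral>\<omega>. (\<Prod>j\<in>J. g j (X j \<omega>)) \<partial>P\<^sub>\<mu>)"
  using assms(1,2,4,5)
proof (induction arbitrary: g rule: finite_linorder_max_induct)
  case empty
  show ?case by simp
next
  case (insert b A)
  note g [measurable] = insert.prems(2) and g1 = insert.prems(3)
  have b: "0 \<le> b" "b \<notin> A" using insert by auto
  show ?case
  proof (cases "A = {}")
    case True
    then show ?thesis
      using a b by (simp add: integral_marginal_P)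
  next
    case False
    define m where "m = Max A"
    have m: "m \<in> A" "\<And>j. j \<in> A \<Longrightarrow> j \<le> m"
      using insert.hyps(1) False by (auto simp: m_def)
    with insert have mb: "0 \<le> m" "m < b" by auto
    define h where "h = semigroup_op X Q (b - m) (g b)"
    have hm [measurable]: "h \<in> borel_measurable borel"
      unfolding h_def using mb by (intro semigroup_op_measurable) auto
    have h1: "\<bar>h x\<bar> \<le> 1" for x
      unfolding h_def using mb g1 by (intro semigroup_op_bound) auto
    define g' where "g' = g(m := (\<lambda>x. g m x * h x))"
    have g': "g' j \<in> borel_measurable borel" "\<bar>g' j x\<bar> \<le> 1" for j x
      using g1 h1 by (auto simp: g'_def abs_mult mult_le_one)
    have step: "(\<integral>\<omega>. (\<Prod>j\<in>insert b A. g j (X (c + j) \<omega>)) \<partial>P\<^sub>\<mu>) = (\<integral>\<omega>. (\<Prod>j\<in>A. g' j (X (c + j) \<omega>)) \<partial>P\<^sub>\<mu>)"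
      if c: "0 \<le> c" for c
    proof -
      let ?F = "\<lambda>\<omega>. \<Prod>j\<in>A. g j (X (c + j) \<omega>)"
      have "X (c + j) \<in> borel_measurable (past M X (ennreal (c + m)))" if "j \<in> A" for j
        using m(2)[OF that] that c insert.prems(1) by (intro measurable_past) auto
      then have F: "?F \<in> borel_measurable (past M X (ennreal (c + m)))"
        by (intro borel_measurable_prod measurable_compose[OF _ g])
      have F1: "\<bar>?F \<omega>\<bar> \<le> 1" for \<omega>
        unfolding abs_prod using g1 by (intro prod_le_1) auto
      have "(\<integral>\<omega>. (\<Prod>j\<in>insert b A. g j (X (c + j) \<omega>)) \<partial>P\<^sub>\<mu>)
          = (\<integral>\<omega>. ?F \<omega> * g b (X ((c + m) + (b - m)) \<omega>) \<partial>P\<^sub>\<mu>)"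
        using insert.hyps(1) b by (simp add: mult.commute)
      also have "\<dots> = (\<integral>\<omega>. ?F \<omega> * h (X (c + m) \<omega>) \<partial>P\<^sub>\<mu>)"
        unfolding h_def using c mb F F1 g1 by (intro markov_property_P) auto
      also have "(\<lambda>\<omega>. ?F \<omega> * h (X (c + m) \<omega>)) = (\<lambda>\<omega>. \<Prod>j\<in>A. g' j (X (c + j) \<omega>))"
      proof
        fix \<omega>
        have "(\<Prod>j\<in>A - {m}. g j (X (c + j) \<omega>)) = (\<Prod>j\<in>A - {m}. g' j (X (c + j) \<omega>))"
          by (intro prod.cong) (auto simp: g'_def)
        then show "?F \<omega> * h (X (c + m) \<omega>) = (\<Prod>j\<in>A. g' j (X (c + j) \<omega>))"
          using insert.hyps(1) m(1) by (simp add: prod.remove[of A m] g'_def mult_ac)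
      qed
      finally show ?thesis .
    qed
    have "A \<subseteq> {0..}" using insert.prems(1) by auto
    from insert.IH[OF this g'] show ?thesis
      using step[OF a] step[of 0] by simp
  qed
qed

text \<open>
  Cylinder sets form a generator stable under intersection, so equality of the finite-dimensional laws suffices.
\<close>

lemma path_law_stationary:
  assumes a: "0 \<le> a"
  shows "distr P\<^sub>\<mu> (PiM {0..} (\<lambda>_. borel)) (\<lambda>\<omega>. \<lambda>u\<in>{0..}. X (a + u) \<omega>)
       = distr P\<^sub>\<mu> (PiM {0..} (\<lambda>_. borel)) (\<lambda>\<omega>. \<lambda>u\<in>{0..}. X u \<omega>)"
proof (rule measure_eqI_PiM_infinite)
  interpret prob_space P\<^sub>\<mu> by (rule prob_space_P)
  have XP [measurable]: "X t \<in> borel_measurable P\<^sub>\<mu>" if "0 \<le> t" for t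
    using measurable_X[OF that] by (simp add: measurable_cong_sets[OF sets_P refl])
  have path [measurable]: "(\<lambda>\<omega>. \<lambda>u\<in>{0..}. X (c + u) \<omega>) \<in> P\<^sub>\<mu> \<rightarrow>\<^sub>M PiM {0..} (\<lambda>_. borel)" if "0 \<le> c" for c
    using that by (intro measurable_restrict) auto
  show "finite_measure (distr P\<^sub>\<mu> (PiM {0..} (\<lambda>_. borel)) (\<lambda>\<omega>. \<lambda>u\<in>{0..}. X (a + u) \<omega>))"
    by (intro finite_measure_distr path a)
  fix A :: "real \<Rightarrow> (real ^ 'd) set" and J assume J: "finite J" "J \<subseteq> {0..}" and A: "\<And>i. i \<in> J \<Longrightarrow> A i \<in> sets borel"
  \<comment> \<open>Outside \<open>J\<close> nothing is known about \<open>A\<close>; a default keeps all sets measurable.\<close>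
  define B where "B i = (if i \<in> J then A i else {})" for i
  have B [measurable]: "B i \<in> sets borel" for i using A by (simp add: B_def)
  let ?E = "prod_emb {0..} (\<lambda>_. borel) J (Pi\<^sub>E J A) :: (real \<Rightarrow> real ^ 'd) set"
  have E: "?E \<in> sets (PiM {0..} (\<lambda>_. borel))"
    using J A by (intro sets_PiM_I) auto
  have eq: "emeasure (distr P\<^sub>\<mu> (PiM {0..} (\<lambda>_. borel)) (\<lambda>\<omega>. \<lambda>u\<in>{0..}. X (c + u) \<omega>)) ?E
      = ennreal (\<integral>\<omega>. (\<Prod>j\<in>J. indicator (B j) (X (c + j) \<omega>)) \<partial>P\<^sub>\<mu>)" if c: "0 \<le> c" for c
  proof -
    let ?C = "(\<lambda>\<omega>. \<lambda>u\<in>{0..}. X (c + u) \<omega>) -` ?E \<inter> space P\<^sub>\<mu>"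
    have C: "?C \<in> sets P\<^sub>\<mu>" using path[OF c] E by (rule measurable_sets)
    have "indicator ?C \<omega> = (\<Prod>j\<in>J. indicator (B j) (X (c + j) \<omega>) :: real)" if "\<omega> \<in> space P\<^sub>\<mu>" for \<omega>
    proof (cases "\<forall>j\<in>J. X (c + j) \<omega> \<in> A j")
      case True
      then have "\<omega> \<in> ?C"
        using that J(2) by (auto simp: prod_emb_def PiE_iff)
      then show ?thesis using True by (simp add: B_def)
    next
      case False
      then have "\<omega> \<notin> ?C"
        using J(2) by (auto simp: prod_emb_def PiE_iff restrict_def subset_eq split: if_splits)
      moreover have "(\<Prod>j\<in>J. indicator (B j) (X (c + j) \<omega>) :: real) = 0"
      proof -
        obtain j where "j \<in> J" "X (c + j) \<omega> \<notin> A j" using False by auto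
        then show ?thesis using J(1) by (intro prod_zero bexI[of _ j]) (simp_all add: B_def)
      qed
      ultimately show ?thesis by simp
    qed
    then have "(\<integral>\<omega>. indicator ?C \<omega> \<partial>P\<^sub>\<mu>) = (\<integral>\<omega>. (\<Prod>j\<in>J. indicator (B j) (X (c + j) \<omega>) :: real) \<partial>P\<^sub>\<mu>)"
      by (intro Bochner_Integration.integral_cong) auto
    then have "measure P\<^sub>\<mu> ?C = (\<integral>\<omega>. (\<Prod>j\<in>J. indicator (B j) (X (c + j) \<omega>)) \<partial>P\<^sub>\<mu>)"
      using C by simp
    then show ?thesis
      using path[OF c] E by (simp add: emeasure_distr emeasure_eq_measure)
  qed
  have "(\<integral>\<omega>. (\<Prod>j\<in>J. indicator (B j) (X (a + j) \<omega>)) \<partial>P\<^sub>\<mu>)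
      = (\<integral>\<omega>. (\<Prod>j\<in>J. indicator (B j) (X j \<omega>) :: real) \<partial>P\<^sub>\<mu>)"
    by (rule finite_dimensional_stationarity[OF J a]) (auto simp: indicator_def)
  then show "emeasure (distr P\<^sub>\<mu> (PiM {0..} (\<lambda>_. borel)) (\<lambda>\<omega>. \<lambda>u\<in>{0..}. X (a + u) \<omega>)) ?E
      = emeasure (distr P\<^sub>\<mu> (PiM {0..} (\<lambda>_. borel)) (\<lambda>\<omega>. \<lambda>u\<in>{0..}. X u \<omega>)) ?E"
    using eq[OF a] eq[of 0] by simp
qed simp_all

end

section \<open>Time integrals along stationary continuous paths\<close>

lemma floor_grid_tendsto: "(\<lambda>n. real_of_int \<lfloor>real (Suc n) * x\<rfloor> / real (Suc n)) \<longlonglongrightarrow> x"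
proof (rule real_tendsto_sandwich)
  show "\<forall>\<^sub>F n in sequentially. x - 1 / real (Suc n) \<le> real_of_int \<lfloor>real (Suc n) * x\<rfloor> / real (Suc n)"
  proof (intro always_eventually allI)
    fix n
    have "x - 1 / real (Suc n) = (real (Suc n) * x - 1) / real (Suc n)" by (simp add: diff_divide_distrib)
    also have "\<dots> \<le> real_of_int \<lfloor>real (Suc n) * x\<rfloor> / real (Suc n)"
      by (intro divide_right_mono) linarith+
    finally show "x - 1 / real (Suc n) \<le> real_of_int \<lfloor>real (Suc n) * x\<rfloor> / real (Suc n)" .
  qed
  show "\<forall>\<^sub>F n in sequentially. real_of_int \<lfloor>real (Suc n) * x\<rfloor> / real (Suc n) \<le> x"
  proof (intro always_eventually allI)
    fix n
    have "real_of_int \<lfloor>real (Suc n) * x\<rfloor> / real (Suc n) \<le> (real (Suc n) * x) / real (Suc n)"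
      by (intro divide_right_mono) linarith+
    then show "real_of_int \<lfloor>real (Suc n) * x\<rfloor> / real (Suc n) \<le> x" by simp
  qed
  have "(\<lambda>n. x - 1 / real (Suc n)) \<longlonglongrightarrow> x - 0"
    by (intro tendsto_intros LIMSEQ_Suc[OF lim_1_over_n])
  then show "(\<lambda>n. x - 1 / real (Suc n)) \<longlonglongrightarrow> x" by simp
qed simp

text \<open>
  The process is the pointwise limit of its values at the grid points \<open>\<lfloor>n s\<rfloor> / n\<close>, which depend on \<open>s\<close>
  through a countable variable only.
\<close>

lemma measurable_pair_of_continuous_paths:
  fixes Y :: "real \<Rightarrow> 'w \<Rightarrow> 'a::metric_space"
  assumes Y: "\<And>s. Y s \<in> borel_measurable N"
    and cont: "\<And>\<omega>. \<omega> \<in> space N \<Longrightarrow> continuous_on UNIV (\<lambda>s. Y s \<omega>)"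
  shows "(\<lambda>(s, \<omega>). Y s \<omega>) \<in> borel_measurable (lborel \<Otimes>\<^sub>M N)"
proof (rule borel_measurable_LIMSEQ_metric)
  fix n :: nat
  let ?r = "\<lambda>k::int. real_of_int k / real (Suc n)"
  show "(\<lambda>z. Y (?r \<lfloor>real (Suc n) * fst z\<rfloor>) (snd z)) \<in> borel_measurable (lborel \<Otimes>\<^sub>M N)"
  proof (rule measurable_compose_countable[where f = "\<lambda>k z. Y (?r k) (snd z)"])
    show "(\<lambda>z. Y (?r k) (snd z)) \<in> borel_measurable (lborel \<Otimes>\<^sub>M N)" for k
      by (rule measurable_compose[OF measurable_snd Y])
    show "(\<lambda>z. \<lfloor>real (Suc n) * fst z\<rfloor>) \<in> lborel \<Otimes>\<^sub>M N \<rightarrow>\<^sub>M count_space UNIV"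
      by measurable
  qed
next
  fix z :: "real \<times> 'w" assume z: "z \<in> space (lborel \<Otimes>\<^sub>M N)"
  have "(\<lambda>n. real_of_int \<lfloor>real (Suc n) * fst z\<rfloor> / real (Suc n)) \<longlonglongrightarrow> fst z"
    by (rule floor_grid_tendsto)
  then have "(\<lambda>n. Y (real_of_int \<lfloor>real (Suc n) * fst z\<rfloor> / real (Suc n)) (snd z)) \<longlonglongrightarrow> Y (fst z) (snd z)"
    using z by (intro continuous_on_tendsto_compose[OF cont]) (auto simp: space_pair_measure)
  then show "(\<lambda>n. Y (real_of_int \<lfloor>real (Suc n) * fst z\<rfloor> / real (Suc n)) (snd z)) \<longlonglongrightarrow> (case z of (s, \<omega>) \<Rightarrow> Y s \<omega>)"
    by (simp add: case_prod_beta)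
qed

text \<open>
  The increment of the additive functional over \<open>[a, b]\<close>. A difference of two additive functionals
  would do almost surely, but it depends on the path before \<open>a\<close> through the event that the integrals exist;
  the integral over the window is measurable with respect to the future of \<open>a\<close> on the nose.
\<close>

definition window_integral :: "(real \<Rightarrow> 'w \<Rightarrow> 'a) \<Rightarrow> ('a \<Rightarrow> real) \<Rightarrow> real \<Rightarrow> real \<Rightarrow> 'w \<Rightarrow> real" where
  "window_integral X f a b \<omega> = (LINT s:{a..b}|lborel. f (X s \<omega>))"

text \<open>
  Freezing the process outside \<open>[a, b]\<close> does not change the integral and keeps the paths continuous on
  the real line, so only the times in \<open>[a, b]\<close> need to be measurable. For the past and
  future \<open>\<sigma>\<close>-algebras this precision is essential.
\<close>

lemma window_integral_measurable:
  fixes X :: "real \<Rightarrow> 'w \<Rightarrow> 'a::metric_space"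
  assumes a: "0 \<le> a" and X: "\<And>u. a \<le> u \<Longrightarrow> u \<le> b \<Longrightarrow> X u \<in> borel_measurable N"
    and cont: "\<And>\<omega>. \<omega> \<in> space N \<Longrightarrow> continuous_on {0..} (\<lambda>t. X t \<omega>)"
    and f: "f \<in> borel_measurable borel"
  shows "window_integral X f a b \<in> borel_measurable N"
proof (cases "a \<le> b")
  case True
  define Y where "Y s = X (max a (min b s))" for s
  have Y: "(\<lambda>(s, \<omega>). Y s \<omega>) \<in> borel_measurable (lborel \<Otimes>\<^sub>M N)"
  proof (rule measurable_pair_of_continuous_paths)
    show "Y s \<in> borel_measurable N" for s
      unfolding Y_def using True by (intro X) auto
    show "continuous_on UNIV (\<lambda>s. Y s \<omega>)" if "\<omega> \<in> space N" for \<omega>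
      unfolding Y_def using True a
      by (intro continuous_on_compose2[OF cont[OF that]] continuous_intros) auto
  qed
  have [measurable]: "(\<lambda>(\<omega>, s). f (Y s \<omega>)) \<in> borel_measurable (N \<Otimes>\<^sub>M lborel)"
    using measurable_compose[OF measurable_pair_swap[OF Y] f] by (simp add: case_prod_beta')
  have "(\<lambda>\<omega>. \<integral>s. indicator {a..b} s * f (Y s \<omega>) \<partial>lborel) \<in> borel_measurable N"
    by measurable
  moreover have "indicator {a..b} s * f (Y s \<omega>) = indicator {a..b} s * f (X s \<omega>)" for s \<omega>
    by (simp add: Y_def indicator_def)
  ultimately show ?thesis
    by (simp add: window_integral_def[abs_def] set_lebesgue_integral_def)
next
  case False
  then show ?thesis by (simp add: window_integral_def[abs_def] set_lebesgue_integral_def)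
qed

lemma window_integral_singleton: "window_integral X f a a \<omega> = 0"
proof -
  have "AE s in lborel. s \<noteq> a" by (rule AE_lborel_singleton)
  then have "AE s in lborel. indicator {a..a} s *\<^sub>R f (X s \<omega>) = 0"
    by eventually_elim auto
  then show ?thesis
    unfolding window_integral_def set_lebesgue_integral_def by (rule integral_eq_zero_AE)
qed

text \<open>
  What the proof uses of the diffusion. Shift invariance is stated for the law on the space of all
  functions on \<open>[0, \<infinity>)\<close> with the product \<open>\<sigma>\<close>-algebra.
\<close>

locale stationary_process = prob_space P for P :: "'w measure" +
  fixes X :: "real \<Rightarrow> 'w \<Rightarrow> 'a::euclidean_space" and \<mu> :: "'a measure"
  assumes X_measurable: "\<And>t. 0 \<le> t \<Longrightarrow> X t \<in> borel_measurable P"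
    and X_continuous: "\<And>\<omega>. \<omega> \<in> space P \<Longrightarrow> continuous_on {0..} (\<lambda>t. X t \<omega>)"
    and marginal: "\<And>t. 0 \<le> t \<Longrightarrow> distr P borel (X t) = \<mu>"
    and stationary: "\<And>a. 0 \<le> a \<Longrightarrow>
      distr P (PiM {0..} (\<lambda>_. borel)) (\<lambda>\<omega>. \<lambda>u\<in>{0..}. X (a + u) \<omega>)
      = distr P (PiM {0..} (\<lambda>_. borel)) (\<lambda>\<omega>. \<lambda>u\<in>{0..}. X u \<omega>)"
begin

lemma sets_mu [measurable_cong]: "sets \<mu> = sets borel"
  using marginal[of 0] by (metis order_refl sets_distr)

lemma integrable_marginal:
  fixes \<phi> :: "'a \<Rightarrow> real"
  assumes "0 \<le> t" "integrable \<mu> \<phi>"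
  shows "integrable P (\<lambda>\<omega>. \<phi> (X t \<omega>))" "(\<integral>\<omega>. \<phi> (X t \<omega>) \<partial>P) = (\<integral>x. \<phi> x \<partial>\<mu>)"
proof -
  have "\<phi> \<in> borel_measurable borel"
    using borel_measurable_integrable[OF assms(2)] by (simp add: measurable_cong_sets[OF sets_mu refl])
  then show "integrable P (\<lambda>\<omega>. \<phi> (X t \<omega>))" "(\<integral>\<omega>. \<phi> (X t \<omega>) \<partial>P) = (\<integral>x. \<phi> x \<partial>\<mu>)"
    using integrable_distr_eq[OF X_measurable[OF assms(1)], of \<phi>]
      integral_distr[OF X_measurable[OF assms(1)], of \<phi>] assms
    by (simp_all add: marginal)
qed

text \<open>
  The product \<open>\<sigma>\<close>-algebra does not see continuity, so the integral is not obviously a measurable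
  function of the path. On continuous paths it agrees with \<open>F\<close> below, which reads the path only at
  grid points and takes the limit inside the integral; \<open>F\<close> is measurable on the whole product space, and its
  law is shift invariant.
\<close>

lemma window_integral_law:
  assumes a: "0 \<le> a" and u: "0 \<le> u" and f: "f \<in> borel_measurable borel"
  shows "distr P borel (window_integral X f a (a + u)) = distr P borel (window_integral X f 0 u)"
proof -
  let ?Path = "PiM {0..} (\<lambda>_. borel) :: (real \<Rightarrow> 'a) measure"
  let ?r = "\<lambda>n r. real_of_int \<lfloor>real (Suc n) * r\<rfloor> / real (Suc n)"
  define F where "F y = (\<integral>r. indicator {0..u} r * f (lim (\<lambda>n. y (max 0 (?r n r)))) \<partial>lborel)"
    for y :: "real \<Rightarrow> 'a"
  have "(\<lambda>(y, r). y (max 0 (?r n r))) \<in> borel_measurable (?Path \<Otimes>\<^sub>M lborel)" for n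
  proof -
    have "(\<lambda>z. fst z (max 0 (?r n (snd z)))) \<in> borel_measurable (?Path \<Otimes>\<^sub>M lborel)"
    proof (rule measurable_compose_countable[where f = "\<lambda>k::int. \<lambda>z. fst z (max 0 (real_of_int k / real (Suc n)))"])
      show "(\<lambda>z. fst z (max 0 (real_of_int k / real (Suc n)))) \<in> borel_measurable (?Path \<Otimes>\<^sub>M lborel)" for k
        by (rule measurable_compose[OF measurable_fst measurable_component_singleton]) simp
      show "(\<lambda>z. \<lfloor>real (Suc n) * snd z\<rfloor>) \<in> ?Path \<Otimes>\<^sub>M lborel \<rightarrow>\<^sub>M count_space UNIV"
        by measurable
    qed
    then show ?thesis by (simp add: case_prod_beta')
  qed
  then have "(\<lambda>z. lim (\<lambda>n. case z of (y, r) \<Rightarrow> y (max 0 (?r n r)))) \<in> borel_measurable (?Path \<Otimes>\<^sub>M lborel)"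
    by (rule borel_measurable_lim_metric)
  then have [measurable]: "(\<lambda>(y, r). f (lim (\<lambda>n. y (max 0 (?r n r))))) \<in> borel_measurable (?Path \<Otimes>\<^sub>M lborel)"
    using measurable_compose[OF _ f, of _ "?Path \<Otimes>\<^sub>M lborel"] by (simp only: case_prod_beta')
  have F: "F \<in> borel_measurable ?Path"
    unfolding F_def by measurable
  have path: "(\<lambda>\<omega>. \<lambda>v\<in>{0..}. X (c + v) \<omega>) \<in> P \<rightarrow>\<^sub>M ?Path" if "0 \<le> c" for c
    using that by (intro measurable_restrict X_measurable) auto
  have F_path: "window_integral X f c (c + u) \<omega> = F (\<lambda>v\<in>{0..}. X (c + v) \<omega>)"
    if c: "0 \<le> c" and \<omega>: "\<omega> \<in> space P" for c \<omega>
  proof -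
    have lim: "lim (\<lambda>n. (\<lambda>v\<in>{0..}. X (c + v) \<omega>) (max 0 (?r n r))) = X (c + r) \<omega>" if r: "0 \<le> r" for r
    proof (rule limI)
      have "(\<lambda>n. max 0 (?r n r)) \<longlonglongrightarrow> max 0 r"
        by (intro tendsto_intros floor_grid_tendsto)
      then have "(\<lambda>n. c + max 0 (?r n r)) \<longlonglongrightarrow> c + r"
        using r by (intro tendsto_intros) simp
      then have "(\<lambda>n. X (c + max 0 (?r n r)) \<omega>) \<longlonglongrightarrow> X (c + r) \<omega>"
        using r c by (intro continuous_on_tendsto_compose[OF X_continuous[OF \<omega>]]) auto
      then show "(\<lambda>n. (\<lambda>v\<in>{0..}. X (c + v) \<omega>) (max 0 (?r n r))) \<longlonglongrightarrow> X (c + r) \<omega>"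
        by simp
    qed
    have "window_integral X f c (c + u) \<omega> = (\<integral>s. indicator {c..c + u} s * f (X s \<omega>) \<partial>lborel)"
      by (simp add: window_integral_def set_lebesgue_integral_def)
    also have "\<dots> = (\<integral>r. indicator {c..c + u} (c + 1 * r) * f (X (c + 1 * r) \<omega>) \<partial>lborel)"
      by (subst lborel_integral_real_affine[where c = 1 and t = c]) simp_all
    also have "\<dots> = F (\<lambda>v\<in>{0..}. X (c + v) \<omega>)"
      unfolding F_def
    proof (intro Bochner_Integration.integral_cong refl)
      fix r
      show "indicator {c..c + u} (c + 1 * r) * f (X (c + 1 * r) \<omega>)
          = indicator {0..u} r * f (lim (\<lambda>n. (\<lambda>v\<in>{0..}. X (c + v) \<omega>) (max 0 (?r n r))))"
      proof (cases "0 \<le> r")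
        case True
        show ?thesis unfolding lim[OF True] by (simp add: indicator_def)
      next
        case False
        then show ?thesis by (simp add: indicator_def del: restrict_apply)
      qed
    qed
    finally show ?thesis .
  qed
  have law: "distr P borel (window_integral X f c (c + u))
      = distr (distr P ?Path (\<lambda>\<omega>. \<lambda>v\<in>{0..}. X (c + v) \<omega>)) borel F" if c: "0 \<le> c" for c
    using c by (subst distr_distr[OF F path]) (auto intro!: distr_cong simp: F_path)
  show ?thesis
    using law[OF a] law[of 0] stationary[OF a] by simp
qed

text \<open>
  Fubini's theorem on \<open>[0, t]\<close> times the probability space: for each fixed time the integrand has the
  \<open>L\<^sup>1\<close>-norm of \<open>\<phi>\<close> under \<open>\<mu>\<close>. In particular almost every path has a genuine, not a default, integral.
\<close>

lemma time_integral_integrable: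
  fixes \<phi> :: "'a \<Rightarrow> real"
  assumes \<phi>: "integrable \<mu> \<phi>"
  shows "AE \<omega> in P. set_integrable lborel {0..t} (\<lambda>s. \<phi> (X s \<omega>))"
    and "integrable P (window_integral X \<phi> 0 t)"
    and "0 \<le> t \<Longrightarrow> (\<integral>\<omega>. window_integral X \<phi> 0 t \<omega> \<partial>P) = t * (\<integral>x. \<phi> x \<partial>\<mu>)"
proof -
  interpret L: pair_sigma_finite lborel P ..
  have \<phi>m: "\<phi> \<in> borel_measurable borel"
    using borel_measurable_integrable[OF \<phi>] by (simp add: measurable_cong_sets[OF sets_mu refl])
  \<comment> \<open>Only times \<open>s \<ge> 0\<close> are meaningful; the process is continued by its value at \<open>0\<close>.\<close>
  have "(\<lambda>(s, \<omega>). X (max 0 s) \<omega>) \<in> borel_measurable (lborel \<Otimes>\<^sub>M P)"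
    by (intro measurable_pair_of_continuous_paths X_measurable
        continuous_on_compose2[OF X_continuous] continuous_intros) auto
  then have [measurable]: "(\<lambda>(s, \<omega>). \<phi> (X (max 0 s) \<omega>)) \<in> borel_measurable (lborel \<Otimes>\<^sub>M P)"
    using measurable_compose[OF _ \<phi>m] by (simp add: case_prod_beta')
  define G where "G s \<omega> = indicator {0..t} s * \<phi> (X (max 0 s) \<omega>)" for s \<omega>
  have G: "(\<lambda>(s, \<omega>). G s \<omega>) \<in> borel_measurable (lborel \<Otimes>\<^sub>M P)"
    unfolding G_def by measurable
  have GX: "G s \<omega> = indicator {0..t} s *\<^sub>R \<phi> (X s \<omega>)" for s \<omega>
    by (auto simp: G_def indicator_def)
  have "integrable (lborel \<Otimes>\<^sub>M P) (\<lambda>(s, \<omega>). G s \<omega>)"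
  proof (rule L.Fubini_integrable[OF G])
    have "(\<integral>\<omega>. norm (G s \<omega>) \<partial>P) = indicator {0..t} s *\<^sub>R (\<integral>x. norm (\<phi> x) \<partial>\<mu>)" for s
      using integrable_marginal(2)[OF _ integrable_norm[OF \<phi>], of "max 0 s"]
      by (simp add: G_def abs_mult)
    moreover have "integrable lborel (indicator {0..t} :: real \<Rightarrow> real)"
      by (rule integrable_real_indicator) (auto simp: emeasure_lborel_Icc_eq)
    ultimately show "integrable lborel (\<lambda>s. \<integral>\<omega>. norm (case (s, \<omega>) of (s, \<omega>) \<Rightarrow> G s \<omega>) \<partial>P)"
      by simp
    show "AE s in lborel. integrable P (\<lambda>\<omega>. case (s, \<omega>) of (s, \<omega>) \<Rightarrow> G s \<omega>)"
      using integrable_marginal(1)[OF _ \<phi>] by (simp add: G_def)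
  qed
  note int = this
  show "AE \<omega> in P. set_integrable lborel {0..t} (\<lambda>s. \<phi> (X s \<omega>))"
    using L.AE_integrable_snd[OF int] by (simp add: GX set_integrable_def)
  show "integrable P (window_integral X \<phi> 0 t)"
    using L.integrable_snd[OF int]
    by (simp add: GX window_integral_def[abs_def] set_lebesgue_integral_def)
  assume t: "0 \<le> t"
  have "(\<integral>\<omega>. window_integral X \<phi> 0 t \<omega> \<partial>P) = (\<integral>s. (\<integral>\<omega>. G s \<omega> \<partial>P) \<partial>lborel)"
    using L.Fubini_integral[OF int] by (simp add: GX window_integral_def set_lebesgue_integral_def)
  also have "\<dots> = (\<integral>s. indicator {0..t} s *\<^sub>R (\<integral>x. \<phi> x \<partial>\<mu>) \<partial>lborel)"
    using integrable_marginal(2)[OF _ \<phi>] by (simp add: G_def)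
  also have "\<dots> = t * (\<integral>x. \<phi> x \<partial>\<mu>)" using t by simp
  finally show "(\<integral>\<omega>. window_integral X \<phi> 0 t \<omega> \<partial>P) = t * (\<integral>x. \<phi> x \<partial>\<mu>)" .
qed

lemma window_integral_add:
  assumes \<phi>: "integrable \<mu> \<phi>" and abc: "0 \<le> a" "a \<le> b" "b \<le> c"
  shows "AE \<omega> in P. window_integral X \<phi> a c \<omega> = window_integral X \<phi> a b \<omega> + window_integral X \<phi> b c \<omega>"
  using time_integral_integrable(1)[OF \<phi>, of c]
proof eventually_elim
  case (elim \<omega>)
  have "{a..c} = {a..b} \<union> {b..c}" using abc by auto
  moreover have "AE s in lborel. \<not> (s \<in> {a..b} \<and> s \<in> {b..c})"
    using AE_lborel_singleton[of b] by eventually_elim auto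
  moreover have "set_integrable lborel {a..b} (\<lambda>s. \<phi> (X s \<omega>))" "set_integrable lborel {b..c} (\<lambda>s. \<phi> (X s \<omega>))"
    using abc by (auto intro!: set_integrable_subset[OF elim])
  ultimately show ?case
    unfolding window_integral_def by (simp add: set_integral_Un_AE)
qed

end


section \<open>Standard deviation of the integral of a centered function\<close>

text \<open>
  The Cauchy--Schwarz inequality against the constant function: integrate \<open>(c - \<phi>)\<^sup>2 \<ge> 0\<close> with \<open>c\<close>
  the mean of \<open>\<phi>\<close> over the interval.
\<close>

lemma set_integral_square_le:
  fixes \<phi> :: "real \<Rightarrow> real"
  assumes t: "0 < t" and \<phi>: "set_integrable lborel {0..t} \<phi>" "set_integrable lborel {0..t} (\<lambda>s. (\<phi> s)\<^sup>2)"
  shows "(LINT s:{0..t}|lborel. \<phi> s)\<^sup>2 \<le> t * (LINT s:{0..t}|lborel. (\<phi> s)\<^sup>2)"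
proof -
  define A where "A = (LINT s:{0..t}|lborel. \<phi> s)"
  define c where "c = A / t"
  have "integrable lborel (indicator {0..t} :: real \<Rightarrow> real)"
    by (rule integrable_real_indicator) (auto simp: emeasure_lborel_Icc_eq)
  then have const: "set_integrable lborel {0..t} (\<lambda>s. c\<^sup>2)"
    by (simp add: set_integrable_def)
  have "0 \<le> c\<^sup>2 - 2 * c * \<phi> s + (\<phi> s)\<^sup>2" for s
    using zero_le_power2[of "c - \<phi> s"] by (simp add: power2_diff algebra_simps)
  then have "0 \<le> (LINT s:{0..t}|lborel. c\<^sup>2 - 2 * c * \<phi> s + (\<phi> s)\<^sup>2)"
    unfolding set_lebesgue_integral_def by (intro integral_nonneg_AE AE_I2) simp
  also have "\<dots> = (LINT s:{0..t}|lborel. c\<^sup>2 - 2 * c * \<phi> s) + (LINT s:{0..t}|lborel. (\<phi> s)\<^sup>2)"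
    using \<phi> const by (intro set_integral_add set_integral_diff) auto
  also have "(LINT s:{0..t}|lborel. c\<^sup>2 - 2 * c * \<phi> s) = c\<^sup>2 * t - 2 * c * A"
    using \<phi> t const
    by (subst set_integral_diff) (auto simp: A_def set_lebesgue_integral_def)
  also have "c\<^sup>2 * t - 2 * c * A = - (A\<^sup>2 / t)"
    using t by (simp add: c_def power2_eq_square field_simps)
  finally show ?thesis using t by (simp add: A_def field_simps)
qed

lemma (in prob_space) expectation_abs_le_sqrt:
  fixes Y :: "'a \<Rightarrow> real"
  assumes Y: "Y \<in> borel_measurable M" "integrable M (\<lambda>\<omega>. (Y \<omega>)\<^sup>2)"
  shows "integrable M Y" "expectation (\<lambda>\<omega>. \<bar>Y \<omega>\<bar>) \<le> sqrt (expectation (\<lambda>\<omega>. (Y \<omega>)\<^sup>2))"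
proof -
  show int: "integrable M Y"
    using Y by (rule square_integrable_imp_integrable)
  have "0 \<le> expectation (\<lambda>\<omega>. (\<bar>Y \<omega>\<bar> - expectation (\<lambda>\<omega>. \<bar>Y \<omega>\<bar>))\<^sup>2)"
    by (rule variance_positive)
  also have "\<dots> = expectation (\<lambda>\<omega>. (Y \<omega>)\<^sup>2) - (expectation (\<lambda>\<omega>. \<bar>Y \<omega>\<bar>))\<^sup>2"
    using variance_eq[of "\<lambda>\<omega>. \<bar>Y \<omega>\<bar>"] int Y(2) by simp
  finally show "expectation (\<lambda>\<omega>. \<bar>Y \<omega>\<bar>) \<le> sqrt (expectation (\<lambda>\<omega>. (Y \<omega>)\<^sup>2))"
    by (intro real_le_rsqrt) simp
qed

locale centered_time_integral = stationary_process P X \<mu>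
  for P :: "'w measure" and X :: "real \<Rightarrow> 'w \<Rightarrow> 'a::euclidean_space" and \<mu> :: "'a measure" +
  fixes f :: "'a \<Rightarrow> real"
  assumes f_measurable: "f \<in> borel_measurable borel"
    and f_square: "integrable \<mu> (\<lambda>x. (f x)\<^sup>2)"
    and f_mean: "(\<integral>x. f x \<partial>\<mu>) = 0"
begin

abbreviation S :: "real \<Rightarrow> real \<Rightarrow> 'w \<Rightarrow> real" where
  "S \<equiv> window_integral X f"

text \<open>
  The root of the second moment; since the integral is centered this is its standard deviation
  (\<open>std_dev_eq\<close>).
\<close>

definition std_dev :: "real \<Rightarrow> real" where
  "std_dev t = sqrt (expectation (\<lambda>\<omega>. (S 0 t \<omega>)\<^sup>2))"

lemma f_integrable: "integrable \<mu> f"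
proof -
  interpret mu: prob_space \<mu>
    using prob_space_distr[OF X_measurable[of 0]] by (simp add: marginal)
  have "f \<in> borel_measurable \<mu>"
    using f_measurable by (simp add: measurable_cong_sets[OF sets_mu refl])
  then show ?thesis using f_square by (rule mu.square_integrable_imp_integrable)
qed

lemma S_measurable [measurable]: "0 \<le> a \<Longrightarrow> S a b \<in> borel_measurable P"
  by (rule window_integral_measurable) (auto intro: X_measurable X_continuous f_measurable)

lemma std_dev_nonneg: "0 \<le> std_dev t"
  by (simp add: std_dev_def)

lemma S_mean: "0 \<le> t \<Longrightarrow> expectation (S 0 t) = 0"
  using time_integral_integrable(3)[OF f_integrable] f_mean by simp

lemma S_square_integrable:
  assumes "0 < t"
  shows "integrable P (\<lambda>\<omega>. (S 0 t \<omega>)\<^sup>2)"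
proof (rule Bochner_Integration.integrable_bound)
  show "integrable P (\<lambda>\<omega>. t * window_integral X (\<lambda>x. (f x)\<^sup>2) 0 t \<omega>)"
    using time_integral_integrable(2)[OF f_square] by simp
  show "AE \<omega> in P. norm ((S 0 t \<omega>)\<^sup>2) \<le> norm (t * window_integral X (\<lambda>x. (f x)\<^sup>2) 0 t \<omega>)"
    using time_integral_integrable(1)[OF f_integrable, of t] time_integral_integrable(1)[OF f_square, of t]
  proof eventually_elim
    case (elim \<omega>)
    have "(S 0 t \<omega>)\<^sup>2 \<le> t * window_integral X (\<lambda>x. (f x)\<^sup>2) 0 t \<omega>"
      unfolding window_integral_def using assms elim by (rule set_integral_square_le)
    then show ?case by simp
  qed
qed (use assms in measurable)

lemma S_law:
  assumes "0 \<le> a" "a \<le> b" "g \<in> borel_measurable borel"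
  shows "integrable P (\<lambda>\<omega>. g (S a b \<omega>) :: real) \<longleftrightarrow> integrable P (\<lambda>\<omega>. g (S 0 (b - a) \<omega>))"
    and "expectation (\<lambda>\<omega>. g (S a b \<omega>) :: real) = expectation (\<lambda>\<omega>. g (S 0 (b - a) \<omega>))"
proof -
  have "distr P borel (S a b) = distr P borel (S 0 (b - a))"
    using window_integral_law[of a "b - a" f] assms f_measurable by simp
  then show "integrable P (\<lambda>\<omega>. g (S a b \<omega>)) \<longleftrightarrow> integrable P (\<lambda>\<omega>. g (S 0 (b - a) \<omega>))"
    "expectation (\<lambda>\<omega>. g (S a b \<omega>)) = expectation (\<lambda>\<omega>. g (S 0 (b - a) \<omega>))"
    using assms integrable_distr_eq[OF S_measurable assms(3), of a b] integrable_distr_eq[OF S_measurable assms(3), of 0 "b - a"]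
      integral_distr[OF S_measurable assms(3), of a b] integral_distr[OF S_measurable assms(3), of 0 "b - a"]
    by simp_all
qed

text \<open>
  The estimate that makes the removed pieces negligible: an increment over a window is controlled
  in \<open>L\<^sup>1\<close> by the standard deviation of the integral over an interval of the same length.
\<close>

lemma S_abs_mean:
  assumes "0 \<le> a" "a \<le> b"
  shows "integrable P (S a b)" "expectation (\<lambda>\<omega>. \<bar>S a b \<omega>\<bar>) \<le> std_dev (b - a)"
proof -
  have "integrable P (\<lambda>\<omega>. (S 0 (b - a) \<omega>)\<^sup>2)"
    using S_square_integrable[of "b - a"] assms
    by (cases "a = b") (simp_all add: window_integral_singleton)
  then have "integrable P (\<lambda>\<omega>. (S a b \<omega>)\<^sup>2)"
    using S_law(1)[OF assms, of "\<lambda>x. x\<^sup>2"] by simp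
  moreover have "expectation (\<lambda>\<omega>. (S a b \<omega>)\<^sup>2) = expectation (\<lambda>\<omega>. (S 0 (b - a) \<omega>)\<^sup>2)"
    using S_law(2)[OF assms, of "\<lambda>x. x\<^sup>2"] by simp
  ultimately show "integrable P (S a b)" "expectation (\<lambda>\<omega>. \<bar>S a b \<omega>\<bar>) \<le> std_dev (b - a)"
    using expectation_abs_le_sqrt[OF S_measurable[OF assms(1)], of b] by (simp_all add: std_dev_def)
qed

lemma std_dev_eq: "0 \<le> t \<Longrightarrow> sqrt (variance (S 0 t)) = std_dev t"
  by (simp add: std_dev_def S_mean)

end


section \<open>Covariances and strong mixing\<close>

lemma (in prob_space) expectation_unit_interval:
  fixes F :: "'a \<Rightarrow> real"
  assumes "\<And>\<omega>. \<omega> \<in> space M \<Longrightarrow> 0 \<le> F \<omega> \<and> F \<omega> \<le> 1"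
  shows "0 \<le> expectation F" "expectation F \<le> 1"
proof -
  show "0 \<le> expectation F"
    using assms by (intro integral_nonneg_AE AE_I2) simp
  show "expectation F \<le> 1"
  proof (cases "integrable M F")
    case True
    then have "expectation F \<le> expectation (\<lambda>_. 1)"
      using assms by (intro integral_mono) auto
    then show ?thesis by (simp add: prob_space)
  qed (simp add: not_integrable_integral_eq)
qed

text \<open>
  The supremum in \<^const>\<open>alpha_mix\<close> is a real one, so that the bound rests on the covariances
  being bounded by \<open>1\<close>.
\<close>

lemma (in prob_space) covariance_le_alpha_mix:
  fixes X :: "real \<Rightarrow> 'a \<Rightarrow> 'b::topological_space"
  assumes "0 \<le> s"
    and "F \<in> borel_measurable (past M X (ennreal s))" "G \<in> borel_measurable (future M X (s + r))"
    and "\<And>\<omega>. 0 \<le> F \<omega> \<and> F \<omega> \<le> 1" "\<And>\<omega>. 0 \<le> G \<omega> \<and> G \<omega> \<le> 1"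
  shows "\<bar>covariance M F G\<bar> \<le> alpha_mix M X r"
  unfolding alpha_mix_def
proof (rule cSup_upper)
  show "\<bar>covariance M F G\<bar> \<in> {\<bar>covariance M F G\<bar> |F G s. 0 \<le> s \<and>
     F \<in> borel_measurable (past M X (ennreal s)) \<and> G \<in> borel_measurable (future M X (s + r)) \<and>
     (\<forall>\<omega>\<in>space M. 0 \<le> F \<omega> \<and> F \<omega> \<le> 1 \<and> 0 \<le> G \<omega> \<and> G \<omega> \<le> 1)}"
    using assms by blast
  have "\<bar>covariance M F G\<bar> \<le> 1"
    if FG: "\<forall>\<omega>\<in>space M. 0 \<le> F \<omega> \<and> F \<omega> \<le> 1 \<and> 0 \<le> G \<omega> \<and> G \<omega> \<le> 1" for F G :: "'a \<Rightarrow> real"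
  proof -
    have "0 \<le> expectation (\<lambda>\<omega>. F \<omega> * G \<omega>)" "expectation (\<lambda>\<omega>. F \<omega> * G \<omega>) \<le> 1"
      using FG by (auto intro!: expectation_unit_interval mult_le_one)
    moreover have "0 \<le> expectation F * expectation G" "expectation F * expectation G \<le> 1"
      using expectation_unit_interval[of F] expectation_unit_interval[of G] FG
      by (auto intro!: mult_le_one)
    ultimately show ?thesis by (simp add: covariance_def abs_le_iff)
  qed
  then show "bdd_above {\<bar>covariance M F G\<bar> |F G s. 0 \<le> s \<and>
     F \<in> borel_measurable (past M X (ennreal s)) \<and> G \<in> borel_measurable (future M X (s + r)) \<and>
     (\<forall>\<omega>\<in>space M. 0 \<le> F \<omega> \<and> F \<omega> \<le> 1 \<and> 0 \<le> G \<omega> \<and> G \<omega> \<le> 1)}"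
    by (intro bdd_aboveI[of _ 1]) blast
qed

lemma (in prob_space) covariance_const: "covariance M F (\<lambda>_. c) = 0"
  by (simp add: covariance_def prob_space)

text \<open>
  Split off the last factor: the covariance of the product of the earlier ones with it is one term of the bound,
  and the rest is the previous error times a number in \<open>[0, 1]\<close>.
\<close>

lemma (in prob_space) expectation_prod_diff_le:
  fixes G :: "nat \<Rightarrow> 'a \<Rightarrow> real"
  assumes "\<And>j \<omega>. 0 \<le> G j \<omega> \<and> G j \<omega> \<le> 1"
  shows "\<bar>expectation (\<lambda>\<omega>. \<Prod>j<n. G j \<omega>) - (\<Prod>j<n. expectation (G j))\<bar>
      \<le> (\<Sum>j<n. \<bar>covariance M (\<lambda>\<omega>. \<Prod>i<j. G i \<omega>) (G j)\<bar>)"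
proof (induction n)
  case 0
  then show ?case by (simp add: prob_space)
next
  case (Suc n)
  let ?E = "expectation (\<lambda>\<omega>. \<Prod>j<n. G j \<omega>)" and ?p = "\<Prod>j<n. expectation (G j)"
  have e: "0 \<le> expectation (G n)" "expectation (G n) \<le> 1"
    using assms by (auto intro: expectation_unit_interval)
  have "expectation (\<lambda>\<omega>. \<Prod>j<Suc n. G j \<omega>) - (\<Prod>j<Suc n. expectation (G j))
      = covariance M (\<lambda>\<omega>. \<Prod>i<n. G i \<omega>) (G n) + (?E - ?p) * expectation (G n)"
    by (simp add: covariance_def algebra_simps)
  also have "\<bar>\<dots>\<bar> \<le> \<bar>covariance M (\<lambda>\<omega>. \<Prod>i<n. G i \<omega>) (G n)\<bar> + \<bar>?E - ?p\<bar> * expectation (G n)"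
    using e by (intro order_trans[OF abs_triangle_ineq]) (simp add: abs_mult)
  also have "\<bar>?E - ?p\<bar> * expectation (G n) \<le> \<bar>?E - ?p\<bar>"
    using e by (intro mult_left_le) auto
  finally show ?case using Suc.IH by simp
qed

section \<open>Joint Gaussian limit of the increments\<close>

text \<open>
  The expectation of \<open>g\<close> under the centered normal law of variance \<open>u\<close>, written so that the degenerate case
  \<open>u = 0\<close> (a point mass at \<open>0\<close>) is included.
\<close>

definition gaussian_mean :: "real \<Rightarrow> (real \<Rightarrow> real) \<Rightarrow> real" where
  "gaussian_mean u g = (\<integral>x. g (sqrt u * x) \<partial>std_normal_distribution)"

context centered_time_integral
begin

context
  assumes CLT: "CLT P (S 0) std_dev"
    and std_dev_ratio: "\<And>u. 0 \<le> u \<Longrightarrow> ((\<lambda>t. std_dev (u * t) / std_dev t) \<longlongrightarrow> sqrt u) at_top"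
begin

text \<open>
  A ratio with zero denominator is \<open>0\<close>, so the ratio for \<open>u = 1\<close> could not tend to \<open>1\<close> otherwise.
\<close>

lemma eventually_std_dev_pos: "0 < u \<Longrightarrow> \<forall>\<^sub>F t in at_top. 0 < std_dev (u * t)"
proof -
  assume u: "0 < u"
  have "\<forall>\<^sub>F t in at_top. 1 / 2 < std_dev (1 * t) / std_dev t"
    by (rule order_tendstoD(1)[OF std_dev_ratio]) auto
  then have "\<forall>\<^sub>F t in at_top. 0 < std_dev t"
    by eventually_elim (use std_dev_nonneg in \<open>force simp: less_le\<close>)
  moreover have "filterlim (\<lambda>t. u * t) at_top at_top"
    by (rule filterlim_tendsto_pos_mult_at_top[OF tendsto_const u filterlim_ident])
  ultimately show ?thesis
    by (rule eventually_compose_filterlim)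
qed

text \<open>
  Slutsky's argument: \<open>S 0 (u t) / std_dev t\<close> is the normalized integral at time \<open>u t\<close> multiplied by a ratio
  that tends to \<open>\<surd>u\<close>. A Lipschitz test function feels the difference at most by a multiple of
  the distance of the ratio to \<open>\<surd>u\<close>, as the normalized integral has \<open>L\<^sup>1\<close>-norm at most \<open>1\<close>.
\<close>

lemma marginal_limit:
  assumes g: "lip_test g" and u: "0 \<le> u"
  shows "((\<lambda>t. expectation (\<lambda>\<omega>. g (S 0 (u * t) \<omega> / std_dev t))) \<longlongrightarrow> gaussian_mean u g) at_top"
proof (cases "u = 0")
  case True
  interpret N: prob_space std_normal_distribution
    by (rule prob_space_normal_density) simp
  show ?thesis
    using N.prob_space by (simp add: True window_integral_singleton gaussian_mean_def prob_space)
next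
  case False
  with u have u: "0 < u" by simp
  obtain L where L: "L-lipschitz_on UNIV g" using g by (auto simp: lip_test_def)
  note L0 = lipschitz_on_nonneg[OF L]
  note [measurable] = lip_testD(4)[OF g]
  have ut: "filterlim (\<lambda>t. u * t) at_top at_top"
    by (rule filterlim_tendsto_pos_mult_at_top[OF tendsto_const u filterlim_ident])
  have "continuous_on UNIV (\<lambda>x. g (sqrt u * x))"
    by (rule continuous_on_compose2[OF lip_testD(3)[OF g]]) (auto intro!: continuous_intros)
  moreover have "bounded (range (\<lambda>x. g (sqrt u * x)))"
    using lip_testD(1,2)[OF g] by (auto simp: bounded_iff intro!: exI[of _ 1])
  ultimately have "((\<lambda>t. \<integral>x. g (sqrt u * x) \<partial>distr P borel (\<lambda>\<omega>. S 0 t \<omega> / std_dev t)) \<longlongrightarrow> gaussian_mean u g) at_top"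
    using CLT unfolding CLT_def converges_in_law_def gaussian_mean_def by blast
  moreover have "(\<integral>x. g (sqrt u * x) \<partial>distr P borel (\<lambda>\<omega>. S 0 t \<omega> / std_dev t))
      = expectation (\<lambda>\<omega>. g (sqrt u * (S 0 t \<omega> / std_dev t)))" for t
    by (rule integral_distr) measurable
  ultimately have "((\<lambda>t. expectation (\<lambda>\<omega>. g (sqrt u * (S 0 t \<omega> / std_dev t)))) \<longlongrightarrow> gaussian_mean u g) at_top"
    by simp
  from filterlim_compose[OF this ut]
  have lim: "((\<lambda>t. expectation (\<lambda>\<omega>. g (sqrt u * (S 0 (u * t) \<omega> / std_dev (u * t))))) \<longlongrightarrow> gaussian_mean u g) at_top"
    by simp
  have "((\<lambda>t. expectation (\<lambda>\<omega>. g (S 0 (u * t) \<omega> / std_dev t))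
      - expectation (\<lambda>\<omega>. g (sqrt u * (S 0 (u * t) \<omega> / std_dev (u * t))))) \<longlongrightarrow> 0) at_top"
  proof (rule Lim_null_comparison)
    have "((\<lambda>t. L * \<bar>std_dev (u * t) / std_dev t - sqrt u\<bar>) \<longlongrightarrow> L * \<bar>sqrt u - sqrt u\<bar>) at_top"
      using u by (intro tendsto_intros std_dev_ratio) simp
    then show "((\<lambda>t. L * \<bar>std_dev (u * t) / std_dev t - sqrt u\<bar>) \<longlongrightarrow> 0) at_top" by simp
    show "\<forall>\<^sub>F t in at_top. norm (expectation (\<lambda>\<omega>. g (S 0 (u * t) \<omega> / std_dev t))
      - expectation (\<lambda>\<omega>. g (sqrt u * (S 0 (u * t) \<omega> / std_dev (u * t)))))
      \<le> L * \<bar>std_dev (u * t) / std_dev t - sqrt u\<bar>"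
      using eventually_std_dev_pos[OF u] eventually_ge_at_top[of 0]
    proof eventually_elim
      case (elim t)
      define c where "c = \<bar>std_dev (u * t) / std_dev t - sqrt u\<bar>"
      have ut0: "0 \<le> u * t" using u elim by simp
      have pt: "\<bar>g (S 0 (u * t) \<omega> / std_dev t) - g (sqrt u * (S 0 (u * t) \<omega> / std_dev (u * t)))\<bar>
          \<le> L * (c * (\<bar>S 0 (u * t) \<omega>\<bar> / std_dev (u * t)))" for \<omega>
      proof -
        have "\<bar>g (S 0 (u * t) \<omega> / std_dev t) - g (sqrt u * (S 0 (u * t) \<omega> / std_dev (u * t)))\<bar>
            \<le> L * \<bar>S 0 (u * t) \<omega> / std_dev t - sqrt u * (S 0 (u * t) \<omega> / std_dev (u * t))\<bar>"
          using lipschitz_onD[OF L] by (simp add: dist_real_def)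
        also have "S 0 (u * t) \<omega> / std_dev t - sqrt u * (S 0 (u * t) \<omega> / std_dev (u * t))
            = (std_dev (u * t) / std_dev t - sqrt u) * (S 0 (u * t) \<omega> / std_dev (u * t))"
          using elim by (simp add: left_diff_distrib diff_divide_distrib)
        also have "\<bar>\<dots>\<bar> = c * (\<bar>S 0 (u * t) \<omega>\<bar> / std_dev (u * t))"
          using elim by (simp add: abs_mult c_def)
        finally show ?thesis .
      qed
      have "\<bar>expectation (\<lambda>\<omega>. g (S 0 (u * t) \<omega> / std_dev t))
          - expectation (\<lambda>\<omega>. g (sqrt u * (S 0 (u * t) \<omega> / std_dev (u * t))))\<bar>
        = \<bar>expectation (\<lambda>\<omega>. g (S 0 (u * t) \<omega> / std_dev t) - g (sqrt u * (S 0 (u * t) \<omega> / std_dev (u * t))))\<bar>"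
        by (subst Bochner_Integration.integral_diff) (auto intro!: integrable_lip_test[OF g])
      also have "\<dots> \<le> expectation (\<lambda>\<omega>. \<bar>g (S 0 (u * t) \<omega> / std_dev t) - g (sqrt u * (S 0 (u * t) \<omega> / std_dev (u * t)))\<bar>)"
        by (rule integral_abs_bound)
      also have "\<dots> \<le> expectation (\<lambda>\<omega>. L * (c * (\<bar>S 0 (u * t) \<omega>\<bar> / std_dev (u * t))))"
        using S_abs_mean(1)[of 0 "u * t"] ut0
        by (intro integral_mono pt integrable_abs Bochner_Integration.integrable_diff
            integrable_lip_test[OF g] integrable_mult_right integrable_divide) auto
      also have "\<dots> = L * (c * (expectation (\<lambda>\<omega>. \<bar>S 0 (u * t) \<omega>\<bar>) / std_dev (u * t)))"
        by simp
      also have "\<dots> \<le> L * (c * 1)"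
        using S_abs_mean(2)[of 0 "u * t"] ut0 elim L0
        by (intro mult_left_mono) (auto simp: c_def)
      finally show ?case by (simp add: c_def)
    qed
  qed
  from tendsto_add[OF this lim] show ?thesis by simp
qed

text \<open>
  The distance \<open>D t\<close> between the expectation of the product and the product of the expectations
  tends to \<open>0\<close>. For given \<open>\<delta>\<close> it is at most \<open>R t\<close>, which collects twice the cost of
  removing the first fraction \<open>\<delta>\<close> of every window (once inside the joint expectation, once inside the
  separate ones) and the covariances of the shortened increments.
\<close>

lemma product_limit:
  fixes \<sigma> :: "nat \<Rightarrow> real"
  assumes mixing: "strongly_mixing P X"
    and \<sigma>: "0 \<le> \<sigma> 0" "mono \<sigma>" and g: "\<And>j. lip_test (g j)"
  shows "((\<lambda>t. expectation (\<lambda>\<omega>. \<Prod>j<n. g j (S (\<sigma> j * t) (\<sigma> (Suc j) * t) \<omega> / std_dev t)))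
      \<longlongrightarrow> (\<Prod>j<n. gaussian_mean (\<sigma> (Suc j) - \<sigma> j) (g j))) at_top"
proof -
  define u where "u j = \<sigma> (Suc j) - \<sigma> j" for j
  have u: "0 \<le> u j" for j using monoD[OF \<sigma>(2), of j "Suc j"] by (simp add: u_def)
  have \<sigma>0: "0 \<le> \<sigma> j" for j using \<sigma>(1) monoD[OF \<sigma>(2), of 0 j] by simp
  obtain L where L: "\<And>j. (L j)-lipschitz_on UNIV (g j)"
    using g unfolding lip_test_def by metis
  note [measurable] = lip_testD(4)[OF g]
  define Z where "Z t j \<omega> = S (\<sigma> j * t) (\<sigma> (Suc j) * t) \<omega> / std_dev t" for t j \<omega>
  define D where "D t = \<bar>expectation (\<lambda>\<omega>. \<Prod>j<n. g j (Z t j \<omega>)) - (\<Prod>j<n. expectation (\<lambda>\<omega>. g j (Z t j \<omega>)))\<bar>" for t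
  have Zm [measurable]: "Z t j \<in> borel_measurable P" if "0 < t" for t j
    unfolding Z_def using that \<sigma>0 by (intro borel_measurable_divide S_measurable borel_measurable_const) simp
  have "(D \<longlongrightarrow> 0) at_top"
  proof (rule tendstoI)
    fix e :: real assume e: "0 < e"
    \<comment> \<open>This sum is the limit of the cost of shortening as \<open>t \<rightarrow> \<infinity>\<close>; it vanishes with \<open>\<delta>\<close>.\<close>
    have "((\<lambda>\<delta>. 2 * (\<Sum>j<n. L j * sqrt (\<delta> * u j))) \<longlongrightarrow> 2 * (\<Sum>j<n. L j * sqrt (0 * u j))) (at_right 0)"
      by (intro tendsto_intros)
    then have "\<forall>\<^sub>F \<delta> in at_right 0. 2 * (\<Sum>j<n. L j * sqrt (\<delta> * u j)) < e"
      using e by (intro order_tendstoD(2)) auto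
    moreover have "\<forall>\<^sub>F \<delta> in at_right 0. \<delta> \<in> {0<..<1::real}"
      by (rule eventually_at_right_real) simp
    ultimately obtain \<delta> where \<delta>: "0 < \<delta>" "\<delta> < 1" and \<delta>e: "2 * (\<Sum>j<n. L j * sqrt (\<delta> * u j)) < e"
      using eventually_happens[OF eventually_conj] by force
    define a where "a j = \<sigma> j + \<delta> * u j" for j
    have a: "\<sigma> j \<le> a j" "a j \<le> \<sigma> (Suc j)" for j
      using u[of j] \<delta> mult_right_mono[of \<delta> 1 "u j"] by (auto simp: a_def u_def)
    have a0: "0 \<le> a j" for j using a(1)[of j] \<sigma>0[of j] by simp
    \<comment> \<open>The shortened increments.\<close>
    define V where "V t j \<omega> = S (a j * t) (\<sigma> (Suc j) * t) \<omega> / std_dev t" for t j \<omega>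
    have Vm [measurable]: "V t j \<in> borel_measurable P" if "0 < t" for t j
      unfolding V_def using that a0 by (intro borel_measurable_divide S_measurable borel_measurable_const) simp
    define \<kappa> where "\<kappa> t j = \<bar>covariance P (\<lambda>\<omega>. \<Prod>i<j. g i (V t i \<omega>)) (\<lambda>\<omega>. g j (V t j \<omega>))\<bar>" for t j
    have \<kappa>: "((\<lambda>t. \<kappa> t j) \<longlongrightarrow> 0) at_top" for j
    proof (cases "u j = 0")
      \<comment> \<open>A repeated time leaves no gap, but then the increment is the constant \<open>0\<close>.\<close>
      case True
      then have "a j = \<sigma> (Suc j)" by (simp add: a_def u_def)
      then show ?thesis
        by (simp add: \<kappa>_def V_def window_integral_singleton covariance_const)
    next
      case False
      with u[of j] \<delta> have d: "0 < \<delta> * u j" by simp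
      have "filterlim (\<lambda>t. \<delta> * u j * t) at_top at_top"
        by (rule filterlim_tendsto_pos_mult_at_top[OF tendsto_const d filterlim_ident])
      then have "((\<lambda>t. alpha_mix P X (\<delta> * u j * t)) \<longlongrightarrow> 0) at_top"
        using mixing unfolding strongly_mixing_def by (rule filterlim_compose[rotated])
      then show ?thesis
      proof (rule Lim_null_comparison[rotated])
        show "\<forall>\<^sub>F t in at_top. norm (\<kappa> t j) \<le> alpha_mix P X (\<delta> * u j * t)"
          using eventually_gt_at_top[of 0]
        proof eventually_elim
          case (elim t)
          have "V t i \<in> borel_measurable (past P X (ennreal (\<sigma> j * t)))" if "i < j" for i
          proof -
            have le: "\<sigma> (Suc i) * t \<le> \<sigma> j * t"
              using monoD[OF \<sigma>(2), of "Suc i" j] that elim by (intro mult_right_mono) auto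
            have "X v \<in> borel_measurable (past P X (ennreal (\<sigma> j * t)))"
              if "a i * t \<le> v" "v \<le> \<sigma> (Suc i) * t" for v
              using order_trans[OF that(2) le] that(1) a0[of i] elim order_trans[of 0 "a i * t" v]
              by (intro measurable_past ennreal_leI) auto
            then have "S (a i * t) (\<sigma> (Suc i) * t) \<in> borel_measurable (past P X (ennreal (\<sigma> j * t)))"
              using a0 elim by (intro window_integral_measurable X_continuous f_measurable) auto
            then show ?thesis unfolding V_def by measurable
          qed
          then have F: "(\<lambda>\<omega>. \<Prod>i<j. g i (V t i \<omega>)) \<in> borel_measurable (past P X (ennreal (\<sigma> j * t)))"
            by (intro borel_measurable_prod measurable_compose[OF _ lip_testD(4)[OF g]]) auto
          have "X v \<in> borel_measurable (future P X (a j * t))" if "a j * t \<le> v" for v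
            using that a0[of j] elim order_trans[of 0 "a j * t" v] by (intro measurable_future) auto
          then have "S (a j * t) (\<sigma> (Suc j) * t) \<in> borel_measurable (future P X (a j * t))"
            using a0 elim by (intro window_integral_measurable X_continuous f_measurable) auto
          then have "V t j \<in> borel_measurable (future P X (a j * t))"
            unfolding V_def by measurable
          then have "(\<lambda>\<omega>. g j (V t j \<omega>)) \<in> borel_measurable (future P X (a j * t))"
            by (rule measurable_compose[OF _ lip_testD(4)[OF g]])
          moreover have "a j * t = \<sigma> j * t + \<delta> * u j * t" by (simp add: a_def algebra_simps)
          ultimately have G: "(\<lambda>\<omega>. g j (V t j \<omega>)) \<in> borel_measurable (future P X (\<sigma> j * t + \<delta> * u j * t))"
            by simp
          have "\<kappa> t j \<le> alpha_mix P X (\<delta> * u j * t)"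
            unfolding \<kappa>_def
            by (rule covariance_le_alpha_mix[OF _ F G])
               (use \<sigma>0 elim lip_testD(1,2)[OF g] in \<open>auto intro!: prod_nonneg prod_le_1\<close>)
          then show ?case by (simp add: \<kappa>_def)
        qed
      qed
    qed
    define R where "R t = 2 * (\<Sum>j<n. L j * (std_dev (\<delta> * u j * t) / std_dev t)) + (\<Sum>j<n. \<kappa> t j)" for t
    have "(R \<longlongrightarrow> 2 * (\<Sum>j<n. L j * sqrt (\<delta> * u j)) + (\<Sum>j<n. 0)) at_top"
      unfolding R_def using u \<delta> by (intro tendsto_intros \<kappa> std_dev_ratio) auto
    then have "\<forall>\<^sub>F t in at_top. R t < e"
      using \<delta>e by (intro order_tendstoD(2)) auto
    then show "\<forall>\<^sub>F t in at_top. dist (D t) 0 < e"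
      using eventually_gt_at_top[of 0]
    proof eventually_elim
      case (elim t)
      then have t: "0 < t" by simp
      have gap: "expectation (\<lambda>\<omega>. \<bar>g j (Z t j \<omega>) - g j (V t j \<omega>)\<bar>) \<le> L j * (std_dev (\<delta> * u j * t) / std_dev t)" for j
      proof -
        have le: "0 \<le> \<sigma> j * t" "\<sigma> j * t \<le> a j * t" "a j * t \<le> \<sigma> (Suc j) * t"
          using a t \<sigma>0 by (auto intro!: mult_right_mono)
        have gap_length: "a j * t - \<sigma> j * t = \<delta> * u j * t" by (simp add: a_def algebra_simps)
        have "AE \<omega> in P. \<bar>g j (Z t j \<omega>) - g j (V t j \<omega>)\<bar> \<le> L j * (\<bar>S (\<sigma> j * t) (a j * t) \<omega>\<bar> / std_dev t)"
          using window_integral_add[OF f_integrable le]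
        proof eventually_elim
          case (elim \<omega>)
          have "\<bar>g j (Z t j \<omega>) - g j (V t j \<omega>)\<bar> \<le> L j * \<bar>Z t j \<omega> - V t j \<omega>\<bar>"
            using lipschitz_onD[OF L] by (simp add: dist_real_def)
          also have "Z t j \<omega> - V t j \<omega> = S (\<sigma> j * t) (a j * t) \<omega> / std_dev t"
            using elim by (simp add: Z_def V_def add_divide_distrib)
          finally show ?case using std_dev_nonneg[of t] by simp
        qed
        then have "expectation (\<lambda>\<omega>. \<bar>g j (Z t j \<omega>) - g j (V t j \<omega>)\<bar>)
            \<le> expectation (\<lambda>\<omega>. L j * (\<bar>S (\<sigma> j * t) (a j * t) \<omega>\<bar> / std_dev t))"
          using S_abs_mean(1)[OF le(1,2)] t
          by (intro integral_mono_AE integrable_abs Bochner_Integration.integrable_diff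
              integrable_lip_test[OF g] integrable_mult_right integrable_divide) auto
        also have "\<dots> = L j * (expectation (\<lambda>\<omega>. \<bar>S (\<sigma> j * t) (a j * t) \<omega>\<bar>) / std_dev t)" by simp
        also have "\<dots> \<le> L j * (std_dev (\<delta> * u j * t) / std_dev t)"
          using S_abs_mean(2)[OF le(1,2)] gap_length std_dev_nonneg[of t] lipschitz_on_nonneg[OF L]
          by (intro mult_left_mono divide_right_mono) auto
        finally show ?thesis .
      qed
      have prod_int: "integrable P (\<lambda>\<omega>. \<Prod>j<n. g j (Y j \<omega>))" if "\<And>j. Y j \<in> borel_measurable P" for Y
      proof (rule integrable_const_bound[of _ 1])
        show "AE \<omega> in P. norm (\<Prod>j<n. g j (Y j \<omega>)) \<le> 1"
          using lip_testD(1,2)[OF g] by (auto simp: abs_prod intro!: prod_le_1)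
      qed (use that in measurable)
      have ZV: "\<bar>expectation (\<lambda>\<omega>. \<Prod>j<n. g j (Z t j \<omega>)) - expectation (\<lambda>\<omega>. \<Prod>j<n. g j (V t j \<omega>))\<bar>
          \<le> (\<Sum>j<n. L j * (std_dev (\<delta> * u j * t) / std_dev t))"
      proof -
        have "\<bar>expectation (\<lambda>\<omega>. \<Prod>j<n. g j (Z t j \<omega>)) - expectation (\<lambda>\<omega>. \<Prod>j<n. g j (V t j \<omega>))\<bar>
            = \<bar>expectation (\<lambda>\<omega>. (\<Prod>j<n. g j (Z t j \<omega>)) - (\<Prod>j<n. g j (V t j \<omega>)))\<bar>"
          using t by (subst Bochner_Integration.integral_diff) (auto intro!: prod_int)
        also have "\<dots> \<le> expectation (\<lambda>\<omega>. \<bar>(\<Prod>j<n. g j (Z t j \<omega>)) - (\<Prod>j<n. g j (V t j \<omega>))\<bar>)"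
          by (rule integral_abs_bound)
        also have "\<dots> \<le> expectation (\<lambda>\<omega>. \<Sum>j<n. \<bar>g j (Z t j \<omega>) - g j (V t j \<omega>)\<bar>)"
        proof (rule integral_mono)
          fix \<omega>
          show "\<bar>(\<Prod>j<n. g j (Z t j \<omega>)) - (\<Prod>j<n. g j (V t j \<omega>))\<bar> \<le> (\<Sum>j<n. \<bar>g j (Z t j \<omega>) - g j (V t j \<omega>)\<bar>)"
            using norm_prod_diff[of "{..<n}" "\<lambda>j. g j (Z t j \<omega>)" "\<lambda>j. g j (V t j \<omega>)"] lip_testD(1,2)[OF g]
            by simp
        qed (use t in \<open>auto intro!: prod_int integrable_lip_test[OF g] integrable_abs
            Bochner_Integration.integrable_diff Bochner_Integration.integrable_sum\<close>)
        also have "\<dots> = (\<Sum>j<n. expectation (\<lambda>\<omega>. \<bar>g j (Z t j \<omega>) - g j (V t j \<omega>)\<bar>))"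
          using t by (intro Bochner_Integration.integral_sum integrable_abs
              Bochner_Integration.integrable_diff integrable_lip_test[OF g]) auto
        also have "\<dots> \<le> (\<Sum>j<n. L j * (std_dev (\<delta> * u j * t) / std_dev t))"
          by (intro sum_mono gap)
        finally show ?thesis .
      qed
      have EZV: "\<bar>(\<Prod>j<n. expectation (\<lambda>\<omega>. g j (V t j \<omega>))) - (\<Prod>j<n. expectation (\<lambda>\<omega>. g j (Z t j \<omega>)))\<bar>
          \<le> (\<Sum>j<n. L j * (std_dev (\<delta> * u j * t) / std_dev t))"
      proof -
        have unit: "\<bar>expectation (\<lambda>\<omega>. g j (Y \<omega>))\<bar> \<le> 1" for j Y
          using expectation_unit_interval[of "\<lambda>\<omega>. g j (Y \<omega>)"] lip_testD(1,2)[OF g] by auto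
        have "\<bar>(\<Prod>j<n. expectation (\<lambda>\<omega>. g j (V t j \<omega>))) - (\<Prod>j<n. expectation (\<lambda>\<omega>. g j (Z t j \<omega>)))\<bar>
            \<le> (\<Sum>j<n. \<bar>expectation (\<lambda>\<omega>. g j (V t j \<omega>)) - expectation (\<lambda>\<omega>. g j (Z t j \<omega>))\<bar>)"
          using norm_prod_diff[of "{..<n}" "\<lambda>j. expectation (\<lambda>\<omega>. g j (V t j \<omega>))" "\<lambda>j. expectation (\<lambda>\<omega>. g j (Z t j \<omega>))"]
            unit by simp
        also have "\<dots> \<le> (\<Sum>j<n. L j * (std_dev (\<delta> * u j * t) / std_dev t))"
        proof (rule sum_mono)
          fix j
          have "\<bar>expectation (\<lambda>\<omega>. g j (V t j \<omega>)) - expectation (\<lambda>\<omega>. g j (Z t j \<omega>))\<bar>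
              = \<bar>expectation (\<lambda>\<omega>. g j (Z t j \<omega>) - g j (V t j \<omega>))\<bar>"
            using t by (subst Bochner_Integration.integral_diff) (auto intro!: integrable_lip_test[OF g])
          also have "\<dots> \<le> expectation (\<lambda>\<omega>. \<bar>g j (Z t j \<omega>) - g j (V t j \<omega>)\<bar>)"
            by (rule integral_abs_bound)
          finally show "\<bar>expectation (\<lambda>\<omega>. g j (V t j \<omega>)) - expectation (\<lambda>\<omega>. g j (Z t j \<omega>))\<bar>
              \<le> L j * (std_dev (\<delta> * u j * t) / std_dev t)"
            using gap[of j] by simp
        qed
        finally show ?thesis .
      qed
      have "\<bar>expectation (\<lambda>\<omega>. \<Prod>j<n. g j (V t j \<omega>)) - (\<Prod>j<n. expectation (\<lambda>\<omega>. g j (V t j \<omega>)))\<bar> \<le> (\<Sum>j<n. \<kappa> t j)"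
        unfolding \<kappa>_def using lip_testD(1,2)[OF g] by (intro expectation_prod_diff_le) simp
      with ZV EZV have "D t \<le> R t" unfolding D_def R_def by linarith
      with elim show ?case by (simp add: D_def)
    qed
  qed
  then have "((\<lambda>t. expectation (\<lambda>\<omega>. \<Prod>j<n. g j (Z t j \<omega>)) - (\<Prod>j<n. expectation (\<lambda>\<omega>. g j (Z t j \<omega>)))) \<longlongrightarrow> 0) at_top"
    unfolding D_def by (rule tendsto_rabs_zero_cancel)
  moreover have "((\<lambda>t. \<Prod>j<n. expectation (\<lambda>\<omega>. g j (Z t j \<omega>))) \<longlongrightarrow> (\<Prod>j<n. gaussian_mean (u j) (g j))) at_top"
  proof (rule tendsto_prod)
    fix j
    have "\<forall>\<^sub>F t in at_top. expectation (\<lambda>\<omega>. g j (S 0 (u j * t) \<omega> / std_dev t)) = expectation (\<lambda>\<omega>. g j (Z t j \<omega>))"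
      using eventually_gt_at_top[of 0]
    proof eventually_elim
      case (elim t)
      have "0 \<le> \<sigma> j * t" "\<sigma> j * t \<le> \<sigma> (Suc j) * t"
        using elim \<sigma>0 u[of j] by (auto simp: u_def)
      moreover have "(\<lambda>x. g j (x / std_dev t)) \<in> borel_measurable borel" by measurable
      moreover have "\<sigma> (Suc j) * t - \<sigma> j * t = u j * t" by (simp add: u_def algebra_simps)
      ultimately show ?case
        using S_law(2)[of "\<sigma> j * t" "\<sigma> (Suc j) * t" "\<lambda>x. g j (x / std_dev t)"] by (simp add: Z_def)
    qed
    then show "((\<lambda>t. expectation (\<lambda>\<omega>. g j (Z t j \<omega>))) \<longlongrightarrow> gaussian_mean (u j) (g j)) at_top"
      by (rule Lim_transform_eventually[OF marginal_limit[OF g u]])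
  qed
  ultimately have "((\<lambda>t. expectation (\<lambda>\<omega>. \<Prod>j<n. g j (Z t j \<omega>))) \<longlongrightarrow> (\<Prod>j<n. gaussian_mean (u j) (g j))) at_top"
    using tendsto_add by fastforce
  then show ?thesis by (simp add: Z_def u_def)
qed

end
end

section \<open>Brownian increments and the functional limit theorem\<close>

text \<open>
  Independence of the increments factorizes the expectation, and each factor is Gaussian after rescaling to
  unit variance; a repeated time gives a vanishing increment.
\<close>

lemma brownian_product_expectation:
  fixes \<sigma> :: "nat \<Rightarrow> real"
  assumes W: "standard_brownian_motion W B" and \<sigma>: "0 \<le> \<sigma> 0" "mono \<sigma>" and g: "\<And>j. lip_test (g j)"
  shows "(\<integral>\<omega>. (\<Prod>j<n. g j (B (\<sigma> (Suc j)) \<omega> - B (\<sigma> j) \<omega>)) \<partial>W)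
      = (\<Prod>j<n. gaussian_mean (\<sigma> (Suc j) - \<sigma> j) (g j))"
proof -
  interpret W: prob_space W using W by (simp add: standard_brownian_motion_def)
  interpret N: prob_space std_normal_distribution
    by (rule prob_space_normal_density) simp
  have \<sigma>0: "0 \<le> \<sigma> j" for j using \<sigma>(1) monoD[OF \<sigma>(2), of 0 j] by simp
  have Bm [measurable]: "B (\<sigma> j) \<in> borel_measurable W" for j
    using W \<sigma>0 by (simp add: standard_brownian_motion_def)
  have "W.indep_vars (\<lambda>_. borel) (\<lambda>i \<omega>. B (\<sigma> (Suc i)) \<omega> - B (\<sigma> i) \<omega>) {..<n}"
    using W \<sigma> by (simp add: standard_brownian_motion_def)
  then have "W.indep_vars (\<lambda>_. borel) (\<lambda>i \<omega>. g i (B (\<sigma> (Suc i)) \<omega> - B (\<sigma> i) \<omega>)) {..<n}"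
    by (rule W.indep_vars_compose2) (rule lip_testD(4)[OF g])
  then have "(\<integral>\<omega>. (\<Prod>j<n. g j (B (\<sigma> (Suc j)) \<omega> - B (\<sigma> j) \<omega>)) \<partial>W)
      = (\<Prod>j<n. \<integral>\<omega>. g j (B (\<sigma> (Suc j)) \<omega> - B (\<sigma> j) \<omega>) \<partial>W)"
    by (intro W.indep_vars_lebesgue_integral W.integrable_lip_test[OF g]) auto
  also have "\<dots> = (\<Prod>j<n. gaussian_mean (\<sigma> (Suc j) - \<sigma> j) (g j))"
  proof (rule prod.cong[OF refl])
    fix j
    define u where "u = \<sigma> (Suc j) - \<sigma> j"
    note [measurable] = lip_testD(4)[OF g]
    show "(\<integral>\<omega>. g j (B (\<sigma> (Suc j)) \<omega> - B (\<sigma> j) \<omega>) \<partial>W) = gaussian_mean (\<sigma> (Suc j) - \<sigma> j) (g j)"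
    proof (cases "u = 0")
      case True
      then show ?thesis
        using N.prob_space by (simp add: u_def gaussian_mean_def W.prob_space)
    next
      case False
      with monoD[OF \<sigma>(2), of j "Suc j"] have u: "0 < u" by (simp add: u_def)
      then have "distributed W lborel (\<lambda>\<omega>. B (\<sigma> (Suc j)) \<omega> - B (\<sigma> j) \<omega>) (normal_density 0 (sqrt u))"
        using W \<sigma>0[of j] by (simp add: standard_brownian_motion_def u_def)
      then have dist: "distributed W lborel (\<lambda>\<omega>. (B (\<sigma> (Suc j)) \<omega> - B (\<sigma> j) \<omega>) / sqrt u) std_normal_density"
        using u W.normal_standard_normal_convert[of "sqrt u" "\<lambda>\<omega>. B (\<sigma> (Suc j)) \<omega> - B (\<sigma> j) \<omega>" 0] by simp
      have "gaussian_mean u (g j) = (\<integral>x. std_normal_density x * g j (sqrt u * x) \<partial>lborel)"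
        unfolding gaussian_mean_def by (subst integral_density) auto
      also have "\<dots> = (\<integral>\<omega>. g j (sqrt u * ((B (\<sigma> (Suc j)) \<omega> - B (\<sigma> j) \<omega>) / sqrt u)) \<partial>W)"
        by (rule distributed_integral[OF dist]) auto
      also have "\<dots> = (\<integral>\<omega>. g j (B (\<sigma> (Suc j)) \<omega> - B (\<sigma> j) \<omega>) \<partial>W)"
        using u by simp
      finally show ?thesis by (simp add: u_def)
    qed
  qed
  finally show ?thesis .
qed

context centered_time_integral
begin

lemma S_increment:
  assumes "0 \<le> a" "a \<le> b"
  shows "AE \<omega> in P. S a b \<omega> = S 0 b \<omega> - S 0 a \<omega>"
  using window_integral_add[OF f_integrable, of 0 a b] assms by auto

text \<open>
  Joint convergence of the increments from \<open>product_limit\<close>, carried over to the values by the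
  continuous map of partial sums.
\<close>

lemma FCLT_of_CLT:
  assumes CLT: "CLT P (S 0) std_dev"
    and ratio: "\<And>u. 0 \<le> u \<Longrightarrow> ((\<lambda>t. std_dev (u * t) / std_dev t) \<longlongrightarrow> sqrt u) at_top"
    and mixing: "strongly_mixing P X"
    and W: "standard_brownian_motion W B"
  shows "FCLT P (S 0) std_dev W B"
  unfolding FCLT_def converges_in_law_def
proof (intro allI impI)
  fix n :: nat and \<tau> :: "nat \<Rightarrow> real" and g :: "(nat \<Rightarrow> real) \<Rightarrow> real"
  assume \<tau>: "(\<forall>i<n. 0 < \<tau> i) \<and> (\<forall>i j. i \<le> j \<and> j < n \<longrightarrow> \<tau> i \<le> \<tau> j)"
    and g: "continuous_on UNIV g" "bounded (range g)"
  interpret W: prob_space W using W by (simp add: standard_brownian_motion_def)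
  \<comment> \<open>The times preceded by \<open>0\<close> and continued by the last one, so that \<open>\<sigma>\<close> is monotone on all
    natural numbers, as the independence of Brownian increments is stated for such sequences.\<close>
  define \<sigma> where "\<sigma> k = (if k = 0 \<or> n = 0 then 0 else \<tau> (min (k - 1) (n - 1)))" for k
  have \<sigma>0: "\<sigma> 0 = 0" by (simp add: \<sigma>_def)
  have \<sigma>\<tau>: "\<sigma> (Suc i) = \<tau> i" if "i < n" for i
    using that by (simp add: \<sigma>_def min_absorb1)
  have \<sigma>_mono: "mono \<sigma>"
  proof (rule monoI)
    fix i j :: nat assume "i \<le> j"
    then have "min (i - 1) (n - 1) \<le> min (j - 1) (n - 1)" by (intro min.mono diff_le_mono) auto
    with \<open>i \<le> j\<close> show "\<sigma> i \<le> \<sigma> j"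
      using \<tau> by (auto simp: \<sigma>_def intro: less_imp_le)
  qed
  have \<sigma>_nonneg: "0 \<le> \<sigma> j" for j using monoD[OF \<sigma>_mono, of 0 j] \<sigma>0 by simp
  have Bm [measurable]: "B (\<sigma> j) \<in> borel_measurable W" for j
    using W \<sigma>_nonneg by (simp add: standard_brownian_motion_def)
  define partial_sums where "partial_sums y i = (if i < n then \<Sum>j\<le>i. y j else 0)" for y :: "nat \<Rightarrow> real" and i
  have ps_cont: "continuous_on UNIV partial_sums"
  proof (rule continuous_on_coordinatewise_then_product)
    fix i
    show "continuous_on UNIV (\<lambda>y. partial_sums y i)"
      by (cases "i < n") (auto simp: partial_sums_def intro!: continuous_intros)
  qed
  have telescope: "(\<Sum>j\<le>i. x (\<sigma> (Suc j)) - x (\<sigma> j)) = x (\<tau> i) - x 0" if "i < n" for x :: "real \<Rightarrow> real" and i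
    using sum_lessThan_telescope[of "\<lambda>j. x (\<sigma> j)" "Suc i"] \<sigma>\<tau>[OF that] \<sigma>0
    by (simp add: lessThan_Suc_atMost)
  define Z where "Z t \<omega> j = (if j < n then (S 0 (\<sigma> (Suc j) * t) \<omega> - S 0 (\<sigma> j * t) \<omega>) / std_dev t else 0)" for t \<omega> j
  define Y where "Y \<omega> j = (if j < n then B (\<sigma> (Suc j)) \<omega> - B (\<sigma> j) \<omega> else 0)" for \<omega> j
  have ps_Z: "partial_sums (Z t \<omega>) = (\<lambda>i. if i < n then S 0 (\<tau> i * t) \<omega> / std_dev t else 0)" for t \<omega>
  proof
    fix i
    show "partial_sums (Z t \<omega>) i = (if i < n then S 0 (\<tau> i * t) \<omega> / std_dev t else 0)"
    proof (cases "i < n")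
      case True
      have "partial_sums (Z t \<omega>) i = (\<Sum>j\<le>i. S 0 (\<sigma> (Suc j) * t) \<omega> / std_dev t - S 0 (\<sigma> j * t) \<omega> / std_dev t)"
        using True by (auto simp: partial_sums_def Z_def diff_divide_distrib intro!: sum.cong)
      also have "\<dots> = S 0 (\<tau> i * t) \<omega> / std_dev t"
        by (subst telescope[OF True, of "\<lambda>v. S 0 (v * t) \<omega> / std_dev t"])
           (simp add: window_integral_singleton)
      finally show ?thesis using True by simp
    qed (simp add: partial_sums_def)
  qed
  have ps_Y: "partial_sums (Y \<omega>) = (\<lambda>i. if i < n then B (\<tau> i) \<omega> else 0)" if "B 0 \<omega> = 0" for \<omega>
  proof
    fix i
    show "partial_sums (Y \<omega>) i = (if i < n then B (\<tau> i) \<omega> else 0)"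
    proof (cases "i < n")
      case True
      then have "partial_sums (Y \<omega>) i = (\<Sum>j\<le>i. B (\<sigma> (Suc j)) \<omega> - B (\<sigma> j) \<omega>)"
        by (auto simp: partial_sums_def Y_def intro!: sum.cong)
      also have "\<dots> = B (\<tau> i) \<omega>"
        using that by (subst telescope[OF True, of "\<lambda>v. B v \<omega>"]) simp
      finally show ?thesis using True by simp
    qed (simp add: partial_sums_def)
  qed
  have "((\<lambda>t. expectation (\<lambda>\<omega>. g (partial_sums (Z t \<omega>)))) \<longlongrightarrow> (\<integral>\<omega>. g (partial_sums (Y \<omega>)) \<partial>W)) at_top"
  proof (rule expectation_tendsto_of_product_tests[where g = "\<lambda>y. g (partial_sums y)" and n = n])
    show "(\<lambda>\<omega>. Z t \<omega> j) \<in> borel_measurable P" for t j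
      unfolding Z_def by simp
    show "(\<lambda>\<omega>. Y \<omega> j) \<in> borel_measurable W" for j
      unfolding Y_def by simp
    show "continuous_on UNIV (\<lambda>y. g (partial_sums y))"
      by (rule continuous_on_compose2[OF g(1) ps_cont]) simp
    show "bounded (range (\<lambda>y. g (partial_sums y)))"
      using g(2) by (rule bounded_subset) auto
    fix test :: "nat \<Rightarrow> real \<Rightarrow> real" assume test: "\<And>j. lip_test (test j)"
    note [measurable] = lip_testD(4)[OF test]
    have "\<forall>\<^sub>F t in at_top. expectation (\<lambda>\<omega>. \<Prod>j<n. test j (S (\<sigma> j * t) (\<sigma> (Suc j) * t) \<omega> / std_dev t))
        = expectation (\<lambda>\<omega>. \<Prod>j<n. test j (Z t \<omega> j))"
      using eventually_ge_at_top[of 0]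
    proof eventually_elim
      case (elim t)
      have nn: "0 \<le> \<sigma> j * t" for j using \<sigma>_nonneg elim by simp
      have "AE \<omega> in P. \<forall>j\<in>{..<n}. S (\<sigma> j * t) (\<sigma> (Suc j) * t) \<omega> = S 0 (\<sigma> (Suc j) * t) \<omega> - S 0 (\<sigma> j * t) \<omega>"
        using nn elim monoD[OF \<sigma>_mono] by (intro AE_finite_allI S_increment mult_right_mono) auto
      then show ?case
        using nn by (intro integral_cong_AE) (auto simp: Z_def elim!: eventually_mono)
    qed
    then have "((\<lambda>t. expectation (\<lambda>\<omega>. \<Prod>j<n. test j (Z t \<omega> j)))
        \<longlongrightarrow> (\<Prod>j<n. gaussian_mean (\<sigma> (Suc j) - \<sigma> j) (test j))) at_top"
      using \<sigma>_nonneg by (intro Lim_transform_eventually[OF product_limit[OF CLT ratio mixing _ \<sigma>_mono test]]) auto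
    also have "(\<Prod>j<n. gaussian_mean (\<sigma> (Suc j) - \<sigma> j) (test j)) = (\<integral>\<omega>. (\<Prod>j<n. test j (Y \<omega> j)) \<partial>W)"
      using brownian_product_expectation[where n = n, OF W \<sigma>_nonneg \<sigma>_mono test] by (simp add: Y_def)
    finally show "((\<lambda>t. expectation (\<lambda>\<omega>. \<Prod>j<n. test j (Z t \<omega> j))) \<longlongrightarrow> (\<integral>\<omega>. (\<Prod>j<n. test j (Y \<omega> j)) \<partial>W)) at_top" .
  qed (auto simp: Z_def Y_def prob_space_axioms W.prob_space_axioms)
  then have lim: "((\<lambda>t. expectation (\<lambda>\<omega>. g (\<lambda>i. if i < n then S 0 (\<tau> i * t) \<omega> / std_dev t else 0)))
      \<longlongrightarrow> (\<integral>\<omega>. g (partial_sums (Y \<omega>)) \<partial>W)) at_top"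
    by (simp add: ps_Z)
  have gm [measurable]: "g \<in> borel_measurable borel"
    using g(1) by (rule borel_measurable_continuous_onI)
  have S_vec: "(\<lambda>\<omega> i. if i < n then S 0 (\<tau> i / \<epsilon>) \<omega> / std_dev (1 / \<epsilon>) else 0) \<in> borel_measurable P" for \<epsilon>
    by (rule measurable_coordinatewise_then_product) simp
  have B_vec [measurable]: "(\<lambda>\<omega> i. if i < n then B (\<tau> i) \<omega> else 0) \<in> borel_measurable W"
  proof (rule measurable_coordinatewise_then_product)
    fix i show "(\<lambda>\<omega>. if i < n then B (\<tau> i) \<omega> else 0) \<in> borel_measurable W"
      using Bm[of "Suc i"] \<sigma>\<tau>[of i] by (cases "i < n") auto
  qed
  have Y_vec [measurable]: "(\<lambda>\<omega>. partial_sums (Y \<omega>)) \<in> borel_measurable W"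
    by (rule measurable_compose[OF _ borel_measurable_continuous_onI[OF ps_cont]],
        rule measurable_coordinatewise_then_product) (simp add: Y_def)
  have "AE \<omega> in W. B 0 \<omega> = 0" using W by (simp add: standard_brownian_motion_def)
  then have "(\<integral>\<omega>. g (partial_sums (Y \<omega>)) \<partial>W) = (\<integral>\<omega>. g (\<lambda>i. if i < n then B (\<tau> i) \<omega> else 0) \<partial>W)"
    by (intro integral_cong_AE) (auto simp: ps_Y elim!: eventually_mono)
  also have "\<dots> = (\<integral>x. g x \<partial>distr W borel (\<lambda>\<omega> i. if i < n then B (\<tau> i) \<omega> else 0))"
    by (rule integral_distr[OF B_vec gm, symmetric])
  finally have limit: "(\<integral>\<omega>. g (partial_sums (Y \<omega>)) \<partial>W)
      = (\<integral>x. g x \<partial>distr W borel (\<lambda>\<omega> i. if i < n then B (\<tau> i) \<omega> else 0))" .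
  have "filterlim (\<lambda>\<epsilon>::real. 1 / \<epsilon>) at_top (at_right 0)"
    using filterlim_inverse_at_top_right by (simp only: inverse_eq_divide)
  from filterlim_compose[OF lim this]
  show "((\<lambda>\<epsilon>. \<integral>x. g x \<partial>distr P borel (\<lambda>\<omega> i. if i < n then S 0 (\<tau> i / \<epsilon>) \<omega> / std_dev (1 / \<epsilon>) else 0))
      \<longlongrightarrow> (\<integral>x. g x \<partial>distr W borel (\<lambda>\<omega> i. if i < n then B (\<tau> i) \<omega> else 0))) (at_right 0)"
    unfolding integral_distr[OF S_vec gm] by (simp add: limit cong: if_cong)
qed

end

lemma (in ergodic_diffusion) stationary_process: "stationary_process P\<^sub>\<mu> X \<mu>"
proof -
  interpret prob_space P\<^sub>\<mu> by (rule prob_space_P)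
  show ?thesis
  proof
    show "X t \<in> borel_measurable P\<^sub>\<mu>" if "0 \<le> t" for t
      using measurable_X[OF that] by (simp add: measurable_cong_sets[OF sets_P refl])
    show "continuous_on {0..} (\<lambda>t. X t \<omega>)" if "\<omega> \<in> space P\<^sub>\<mu>" for \<omega>
      using that by (intro continuous_paths) (simp add: space_P)
  qed (simp_all only: marginal_P path_law_stationary)
qed

lemma additive_functional_eq: "additive_functional X f = window_integral X f 0"
  by (simp add: fun_eq_iff additive_functional_def window_integral_def)

theorem proposition8p1:
  fixes M :: "'w measure" and X :: "real \<Rightarrow> 'w \<Rightarrow> real ^ 'd"
    and Q :: "real ^ 'd \<Rightarrow> 'w measure" and \<mu> :: "(real ^ 'd) measure"
    and f :: "real ^ 'd \<Rightarrow> real" and h :: "real \<Rightarrow> real"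
    and W :: "'v measure" and B :: "real \<Rightarrow> 'v \<Rightarrow> real"
  defines "P\<^sub>\<mu> \<equiv> \<mu> \<bind> Q"
    and "S \<equiv> additive_functional X f"
  defines "s \<equiv> \<lambda>t. sqrt (prob_space.variance P\<^sub>\<mu> (S t))"
  assumes "ergodic_diffusion M X Q \<mu>"
    and "f \<in> borel_measurable \<mu>" and "integrable \<mu> (\<lambda>x. (f x)\<^sup>2)"
    and "\<not> (AE x in \<mu>. f x = 0)" and "(\<integral>x. f x \<partial>\<mu>) = 0"
    and "strongly_mixing P\<^sub>\<mu> X"
    and "slowly_varying h" and "\<And>t. 0 \<le> t \<Longrightarrow> prob_space.variance P\<^sub>\<mu> (S t) = t * h t"
    and "CLT P\<^sub>\<mu> S s"
    and "standard_brownian_motion W B"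
  shows "FCLT P\<^sub>\<mu> S s W B"
proof -
  interpret D: ergodic_diffusion M X Q \<mu> by fact
  have P: "P\<^sub>\<mu> = D.P\<^sub>\<mu>" by (simp add: P\<^sub>\<mu>_def D.P\<^sub>\<mu>_def)
  have S: "S = window_integral X f 0" by (simp add: S_def additive_functional_eq)
  interpret stationary_process P\<^sub>\<mu> X \<mu>
    unfolding P by (rule D.stationary_process)
  interpret centered_time_integral P\<^sub>\<mu> X \<mu> f
    by unfold_locales (use assms in \<open>simp_all add: measurable_cong_sets[OF D.sets_mu refl]\<close>)
  have s: "s = std_dev"
  proof
    fix t show "s t = std_dev t"
    proof (cases "0 \<le> t")
      case True
      then show ?thesis by (simp add: s_def S std_dev_eq)
    next
      case False
      then have "window_integral X f 0 t = (\<lambda>_. 0)"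
        by (simp add: fun_eq_iff window_integral_def set_lebesgue_integral_def)
      then show ?thesis by (simp add: s_def S std_dev_def)
    qed
  qed
  \<comment> \<open>Here slow variation enters, through \<open>u t h (u t) / (t h t) = u (h (u t) / h t)\<close>.\<close>
  have "((\<lambda>t. std_dev (u * t) / std_dev t) \<longlongrightarrow> sqrt u) at_top" if u: "0 \<le> u" for u
  proof (cases "u = 0")
    case True
    then show ?thesis by (simp add: std_dev_def window_integral_singleton)
  next
    case False
    with u have u: "0 < u" by simp
    have "((\<lambda>t. sqrt (u * (h (u * t) / h t))) \<longlongrightarrow> sqrt (u * 1)) at_top"
      using assms(10) u unfolding slowly_varying_def by (intro tendsto_intros) auto
    moreover have "\<forall>\<^sub>F t in at_top. sqrt (u * (h (u * t) / h t)) = std_dev (u * t) / std_dev t"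
      using eventually_gt_at_top[of 0]
    proof eventually_elim
      case (elim t)
      have sd: "std_dev t = sqrt (t * h t)" if "0 \<le> t" for t
        unfolding s[symmetric] s_def using assms(11)[OF that] by simp
      have "std_dev (u * t) = sqrt (u * t * h (u * t))" "std_dev t = sqrt (t * h t)"
        using u elim by (auto intro!: sd)
      then have "std_dev (u * t) / std_dev t = sqrt ((u * t * h (u * t)) / (t * h t))"
        by (simp only: real_sqrt_divide)
      also have "(u * t * h (u * t)) / (t * h t) = u * (h (u * t) / h t)"
        using elim by simp
      finally show ?case by simp
    qed
    ultimately show ?thesis by (simp add: Lim_transform_eventually)
  qed
  then show ?thesis
    using assms unfolding s S by (intro FCLT_of_CLT) auto
qed

end
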